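(* Let $\mathcal{Q}$ be a small quantaloid and let $(\mathcal{T},\varepsilon)$ be a full sub-KZ-doctrine of the free cocompletion KZ-doctrine $\mathcal{P}:\mathrm{Cat}(\mathcal{Q})\to\mathrm{Cat}(\mathcal{Q})$. Then $$\mathcal{C}_{\mathcal{T}}:=\{\varepsilon_{\mathbb{A}}(t)\mid \mathbb{A}\in\mathrm{Cat}(\mathcal{Q}),\ t\in\mathcal{T}(\mathbb{A})\}$$ is a saturated class of presheaves on $\mathcal{Q}$-categories. Moreover, the $\mathcal{T}$-algebras are precisely the $\mathcal{C}_{\mathcal{T}}$-cocomplete $\mathcal{Q}$-categories, and the $\mathcal{T}$-algebra homomorphisms are precisely the $\mathcal{C}_{\mathcal{T}}$-cocontinuous functors between the $\mathcal{C}_{\mathcal{T}}$-cocomplete $\mathcal{Q}$-categories.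
   Context: A quantaloid is a category whose hom-sets are complete lattices and whose composition preserves arbitrary suprema in each variable. $\mathcal{Q}$ is a small quantaloid, with set of objects $\mathcal{Q}_0$. A $\mathcal{Q}$-category $\mathbb{A}$ is a set $\mathbb{A}_0$ with a type function $t:\mathbb{A}_0\to\mathcal{Q}_0$ and $\mathcal{Q}$-arrows $\mathbb{A}(a',a):ta\to ta'$ with $1_{ta}\le\mathbb{A}(a,a)$ and $\mathbb{A}(a'',a')\circ\mathbb{A}(a',a)\le\mathbb{A}(a'',a)$. A functor $F:\mathbb{A}\to\mathbb{B}$ is a type-preserving map with $\mathbb{A}(a',a)\le\mathbb{B}(Fa',Fa)$; it is fully faithful if equality always holds. A distributor $\Phi$ from $\mathbb{A}$ to $\mathbb{B}$ is a matrix of arrows $\Phi(b,a):ta\to tb$ with $\Phi(b,a')\circ\mathbb{A}(a',a)\le\Phi(b,a)$ and $\mathbb{B}(b,b')\circ\Phi(b',a)\le\Phi(b,a)$. Composition is $(\Psi\otimes\Phi)(c,a)=\bigvee_b\Psi(c,b)\circ\Phi(b,a)$, the identity on $\mathbb{A}$ is the hom-matrix of $\mathbb{A}$, and distributors are ordered elementwise; this gives a (large) quantaloid $\mathrm{Dist}(\mathcal{Q})$. For $\Phi:\mathbb{A}\to\mathbb{C}$ and $\Psi:\mathbb{B}\to\mathbb{C}$ in $\mathrm{Dist}(\mathcal{Q})$, the lifting $[\Psi,\Phi]:\mathbb{A}\to\mathbb{B}$ is the largest distributor with $\Psi\otimes[\Psi,\Phi]\le\Phi$. A functor $F:\mathbb{A}\to\mathbb{B}$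 gives a distributor $\mathbb{B}(-,F-):\mathbb{A}\to\mathbb{B}$ with right adjoint $\mathbb{B}(F-,-)$. Parallel functors are preordered by $F\le G$ iff $\mathbb{B}(-,F-)\le\mathbb{B}(-,G-)$, and $F\cong G$ means $F\le G\le F$; this makes $\mathrm{Cat}(\mathcal{Q})$ a locally (pre)ordered 2-category. Since local orders are only preorders, equations between functors (naturality, factorisations, monad and algebra laws) are understood up to $\cong$. $*_X$ is the one-object $\mathcal{Q}$-category with object of type $X$ and hom-arrow $1_X$. A presheaf on $\mathbb{A}$ is a distributor $\phi:*_X\to\mathbb{A}$, $X\in\mathcal{Q}_0$. Presheaves on $\mathbb{A}$ are the objects of the $\mathcal{Q}$-category $\mathcal{P}(\mathbb{A})$, with $t\phi=X$ and $\mathcal{P}(\mathbb{A})(\psi,\phi)=$ the single element of $[\psi,\phi]$. The Yoneda embedding is $Y_{\mathbb{A}}:\mathbb{A}\to\mathcal{P}(\mathbb{A}):a\mapsto\mathbb{A}(-,a)$ (the representable presheaves). $\mathcal{P}$ is a 2-functor on $\mathrm{Cat}(\mathcal{Q})$ via $\mathcal{P}(F)(\phi)=\mathbb{B}(-,F-)\otimes\phi$. The colimit of $F:\mathbb{A}\to\mathbb{B}$ weighted by a presheaf $\phi:*_X\to\mathbb{A}$ is an object $\mathrm{colim}(\phi,F)$ of $\mathbb{B}$ of type $X$ with $\mathbb{B}(\mathrm{colim}(\phi,F),-)=[\phi,\mathbb{B}(F-,-)]$. $G:\mathbb{B}\to\mathbb{B}'$ preserves it if $G(\mathrm{colim}(\phi,F))$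 is the $\phi$-weighted colimit of $G\circ F$. In $\mathcal{P}(\mathbb{B})$ all such colimits exist: for $G:\mathbb{A}\to\mathcal{P}(\mathbb{B})$, $\mathrm{colim}(\phi,G)(b)=\bigvee_{a}G(a)(b)\circ\phi(a)$. $\mathcal{P}$ is a 2-monad with unit $Y$ and multiplication $M_{\mathbb{A}}:\mathcal{P}(\mathcal{P}(\mathbb{A}))\to\mathcal{P}(\mathbb{A}):\Theta\mapsto\mathrm{colim}(\Theta,1_{\mathcal{P}(\mathbb{A})})$. For a class $\mathcal{C}$ of presheaves, a $\mathcal{Q}$-category is $\mathcal{C}$-cocomplete if it has all colimits weighted by elements of $\mathcal{C}$; a functor is $\mathcal{C}$-cocontinuous if it preserves all colimits weighted by elements of $\mathcal{C}$. $\mathcal{C}$ is saturated if (1) it contains all representable presheaves and (2) for each $\phi:*_X\to\mathbb{A}$ in $\mathcal{C}$ and each functor $G:\mathbb{A}\to\mathcal{P}(\mathbb{B})$ with every $G(a)$ in $\mathcal{C}$, $\mathrm{colim}(\phi,G)$ is in $\mathcal{C}$. A KZ-doctrine on a locally ordered 2-category $\mathcal{K}$ is a 2-monad $(\mathcal{T},\mu,\eta)$ on $\mathcal{K}$ with $\mathcal{T}(\eta_K)\le\eta_{\mathcal{T}(K)}$ for all objects $K$. $\mathcal{P}$ is a KZ-doctrine. A full sub-KZ-doctrine of $\mathcal{P}$ is a pair $(\mathcal{T},\varepsilon)$ of a 2-functor $\mathcal{T}$ on $\mathrm{Cat}(\mathcal{Q})$ and a 2-natural transformation $\varepsilon:\mathcal{T}\Rightarrow\mathcal{P}$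 with all components fully faithful, such that there are (essentially unique) factorisations $M\circ(\varepsilon*\varepsilon)=\varepsilon\circ\mu$ and $Y=\varepsilon\circ\eta$, where $(\varepsilon*\varepsilon)_{\mathbb{A}}=\mathcal{P}(\varepsilon_{\mathbb{A}})\circ\varepsilon_{\mathcal{T}(\mathbb{A})}$; then $(\mathcal{T},\mu,\eta)$ is a KZ-doctrine. A $\mathcal{T}$-algebra is a $\mathcal{Q}$-category $\mathbb{B}$ with a functor $L:\mathcal{T}(\mathbb{B})\to\mathbb{B}$ satisfying $L\circ\eta_{\mathbb{B}}\cong1$ and $L\circ\mu_{\mathbb{B}}\cong L\circ\mathcal{T}(L)$; for a KZ-doctrine such $L$ is left adjoint to $\eta_{\mathbb{B}}$, so it is essentially unique and being an algebra is a property. A homomorphism $G:(\mathbb{B},L)\to(\mathbb{B}',L')$ is a functor with $G\circ L\cong L'\circ\mathcal{T}(G)$. *)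

theory Defs
  imports "HOL-Algebra.Complete_Lattice"
begin

section \<open>Quantaloids\<close>

record ('o, 'm) quantaloid_data =
  Obj :: "'o set"
  Arr :: "'m set"
  Dom :: "'m \<Rightarrow> 'o"
  Cod :: "'m \<Rightarrow> 'o"
  Idt :: "'o \<Rightarrow> 'm"
  Cmp :: "'m \<Rightarrow> 'm \<Rightarrow> 'm"  (infixl \<open>\<cdot>\<index>\<close> 70)
  Leq :: "'m \<Rightarrow> 'm \<Rightarrow> bool"  (infix \<open>\<preceq>\<index>\<close> 50)

definition Hom :: "('o, 'm) quantaloid_data \<Rightarrow> 'o \<Rightarrow> 'o \<Rightarrow> 'm set" where
  "Hom Q X Y = {f \<in> Arr Q. Dom Q f = X \<and> Cod Q f = Y}"

definition hom_lattice :: "('o, 'm) quantaloid_data \<Rightarrow> 'o \<Rightarrow> 'o \<Rightarrow> 'm gorder" where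
  "hom_lattice Q X Y = \<lparr>carrier = Hom Q X Y, eq = (=), le = Leq Q\<rparr>"

definition Join :: "('o, 'm) quantaloid_data \<Rightarrow> 'o \<Rightarrow> 'o \<Rightarrow> 'm set \<Rightarrow> 'm" where
  "Join Q X Y S = \<Squnion>\<^bsub>hom_lattice Q X Y\<^esub> S"

locale quantaloid =
  fixes Q :: "('o, 'm) quantaloid_data" (structure)
  assumes Dom_Obj: "f \<in> Arr Q \<Longrightarrow> Dom Q f \<in> Obj Q"
    and Cod_Obj: "f \<in> Arr Q \<Longrightarrow> Cod Q f \<in> Obj Q"
    and Idt_Hom: "X \<in> Obj Q \<Longrightarrow> Idt Q X \<in> Hom Q X X"
    and Cmp_Hom: "\<lbrakk>f \<in> Hom Q X Y; g \<in> Hom Q Y Z\<rbrakk> \<Longrightarrow> g \<cdot> f \<in> Hom Q X Z"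
    and Cmp_assoc: "\<lbrakk>f \<in> Hom Q W X; g \<in> Hom Q X Y; h \<in> Hom Q Y Z\<rbrakk>
      \<Longrightarrow> h \<cdot> (g \<cdot> f) = (h \<cdot> g) \<cdot> f"
    and Cmp_Idt_left: "f \<in> Hom Q X Y \<Longrightarrow> Idt Q Y \<cdot> f = f"
    and Cmp_Idt_right: "f \<in> Hom Q X Y \<Longrightarrow> f \<cdot> Idt Q X = f"
    and hom_complete: "\<lbrakk>X \<in> Obj Q; Y \<in> Obj Q\<rbrakk> \<Longrightarrow> complete_lattice (hom_lattice Q X Y)"
    and Cmp_Join_left: "\<lbrakk>X \<in> Obj Q; Y \<in> Obj Q; Z \<in> Obj Q; S \<subseteq> Hom Q Y Z; f \<in> Hom Q X Y\<rbrakk>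
      \<Longrightarrow> Join Q Y Z S \<cdot> f = Join Q X Z ((\<lambda>g. g \<cdot> f) ` S)"
    and Cmp_Join_right: "\<lbrakk>X \<in> Obj Q; Y \<in> Obj Q; Z \<in> Obj Q; g \<in> Hom Q Y Z; S \<subseteq> Hom Q X Y\<rbrakk>
      \<Longrightarrow> g \<cdot> Join Q X Y S = Join Q X Z ((\<lambda>f. g \<cdot> f) ` S)"

section \<open>Categories enriched in a quantaloid, functors and distributors\<close>

text \<open>Types, hom-matrices, object maps and distributors are extensional
  (\<open>undefined\<close> outside the carriers), so that HOL equality of these data is equality
  of the mathematical objects. As usual for \<open>\<A>(a', a)\<close>, the arrow \<^term>\<open>Hm A a' a\<close> goes
  from the type of \<open>a\<close> to the type of \<open>a'\<close>; likewise \<open>\<Phi> b a\<close> for a distributor \<open>\<Phi>\<close>.\<close>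

record ('a, 'o, 'm) qcat =
  Ob :: "'a set"
  Ty :: "'a \<Rightarrow> 'o"
  Hm :: "'a \<Rightarrow> 'a \<Rightarrow> 'm"

definition qcategory :: "('o, 'm) quantaloid_data \<Rightarrow> ('a, 'o, 'm) qcat \<Rightarrow> bool" where
  "qcategory Q A \<longleftrightarrow>
     Ty A \<in> Ob A \<rightarrow>\<^sub>E Obj Q \<and>
     Hm A \<in> (\<Pi>\<^sub>E a'\<in>Ob A. \<Pi>\<^sub>E a\<in>Ob A. Hom Q (Ty A a) (Ty A a')) \<and>
     (\<forall>a\<in>Ob A. Idt Q (Ty A a) \<preceq>\<^bsub>Q\<^esub> Hm A a a) \<and>
     (\<forall>a''\<in>Ob A. \<forall>a'\<in>Ob A. \<forall>a\<in>Ob A. Hm A a'' a' \<cdot>\<^bsub>Q\<^esub> Hm A a' a \<preceq>\<^bsub>Q\<^esub> Hm A a'' a)"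

definition qfunctor :: "('o, 'm) quantaloid_data \<Rightarrow> ('a, 'o, 'm) qcat \<Rightarrow> ('b, 'o, 'm) qcat
    \<Rightarrow> ('a \<Rightarrow> 'b) \<Rightarrow> bool" where
  "qfunctor Q A B F \<longleftrightarrow>
     F \<in> Ob A \<rightarrow>\<^sub>E Ob B \<and>
     (\<forall>a\<in>Ob A. Ty B (F a) = Ty A a) \<and>
     (\<forall>a'\<in>Ob A. \<forall>a\<in>Ob A. Hm A a' a \<preceq>\<^bsub>Q\<^esub> Hm B (F a') (F a))"

definition fully_faithful :: "('a, 'o, 'm) qcat \<Rightarrow> ('b, 'o, 'm) qcat \<Rightarrow> ('a \<Rightarrow> 'b) \<Rightarrow> bool" where
  "fully_faithful A B F \<longleftrightarrow> (\<forall>a'\<in>Ob A. \<forall>a\<in>Ob A. Hm A a' a = Hm B (F a') (F a))"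

abbreviation id_functor :: "('a, 'o, 'm) qcat \<Rightarrow> 'a \<Rightarrow> 'a" where
  "id_functor A \<equiv> (\<lambda>a\<in>Ob A. a)"

abbreviation comp_functor :: "('a, 'o, 'm) qcat \<Rightarrow> ('b \<Rightarrow> 'c) \<Rightarrow> ('a \<Rightarrow> 'b) \<Rightarrow> 'a \<Rightarrow> 'c" where
  "comp_functor A G F \<equiv> compose (Ob A) G F"

definition distributor :: "('o, 'm) quantaloid_data \<Rightarrow> ('a, 'o, 'm) qcat \<Rightarrow> ('b, 'o, 'm) qcat
    \<Rightarrow> ('b \<Rightarrow> 'a \<Rightarrow> 'm) \<Rightarrow> bool" where
  "distributor Q A B \<Phi> \<longleftrightarrow>
     \<Phi> \<in> (\<Pi>\<^sub>E b\<in>Ob B. \<Pi>\<^sub>E a\<in>Ob A. Hom Q (Ty A a) (Ty B b)) \<and>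
     (\<forall>b\<in>Ob B. \<forall>a'\<in>Ob A. \<forall>a\<in>Ob A. \<Phi> b a' \<cdot>\<^bsub>Q\<^esub> Hm A a' a \<preceq>\<^bsub>Q\<^esub> \<Phi> b a) \<and>
     (\<forall>b\<in>Ob B. \<forall>b'\<in>Ob B. \<forall>a\<in>Ob A. Hm B b b' \<cdot>\<^bsub>Q\<^esub> \<Phi> b' a \<preceq>\<^bsub>Q\<^esub> \<Phi> b a)"

definition dist_le :: "('o, 'm) quantaloid_data \<Rightarrow> ('a, 'o, 'm) qcat \<Rightarrow> ('b, 'o, 'm) qcat
    \<Rightarrow> ('b \<Rightarrow> 'a \<Rightarrow> 'm) \<Rightarrow> ('b \<Rightarrow> 'a \<Rightarrow> 'm) \<Rightarrow> bool" where
  "dist_le Q A B \<Phi> \<Phi>' \<longleftrightarrow> (\<forall>b\<in>Ob B. \<forall>a\<in>Ob A. \<Phi> b a \<preceq>\<^bsub>Q\<^esub> \<Phi>' b a)"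

definition dist_comp :: "('o, 'm) quantaloid_data \<Rightarrow> ('a, 'o, 'm) qcat \<Rightarrow> ('b, 'o, 'm) qcat
    \<Rightarrow> ('c, 'o, 'm) qcat \<Rightarrow> ('c \<Rightarrow> 'b \<Rightarrow> 'm) \<Rightarrow> ('b \<Rightarrow> 'a \<Rightarrow> 'm) \<Rightarrow> 'c \<Rightarrow> 'a \<Rightarrow> 'm" where
  "dist_comp Q A B C \<Psi> \<Phi> =
     (\<lambda>c\<in>Ob C. \<lambda>a\<in>Ob A. Join Q (Ty A a) (Ty C c) ((\<lambda>b. \<Psi> c b \<cdot>\<^bsub>Q\<^esub> \<Phi> b a) ` Ob B))"

definition is_lifting :: "('o, 'm) quantaloid_data \<Rightarrow> ('a, 'o, 'm) qcat \<Rightarrow> ('b, 'o, 'm) qcat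
    \<Rightarrow> ('c, 'o, 'm) qcat \<Rightarrow> ('c \<Rightarrow> 'b \<Rightarrow> 'm) \<Rightarrow> ('c \<Rightarrow> 'a \<Rightarrow> 'm) \<Rightarrow> ('b \<Rightarrow> 'a \<Rightarrow> 'm) \<Rightarrow> bool" where
  "is_lifting Q A B C \<Psi> \<Phi> \<Theta> \<longleftrightarrow>
     distributor Q A B \<Theta> \<and> dist_le Q A C (dist_comp Q A B C \<Psi> \<Theta>) \<Phi> \<and>
     (\<forall>\<Theta>'. distributor Q A B \<Theta>' \<and> dist_le Q A C (dist_comp Q A B C \<Psi> \<Theta>') \<Phi>
        \<longrightarrow> dist_le Q A B \<Theta>' \<Theta>)"

definition lifting :: "('o, 'm) quantaloid_data \<Rightarrow> ('a, 'o, 'm) qcat \<Rightarrow> ('b, 'o, 'm) qcat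
    \<Rightarrow> ('c, 'o, 'm) qcat \<Rightarrow> ('c \<Rightarrow> 'b \<Rightarrow> 'm) \<Rightarrow> ('c \<Rightarrow> 'a \<Rightarrow> 'm) \<Rightarrow> 'b \<Rightarrow> 'a \<Rightarrow> 'm" where
  "lifting Q A B C \<Psi> \<Phi> = (THE \<Theta>. is_lifting Q A B C \<Psi> \<Phi> \<Theta>)"

text \<open>The distributors \<open>\<B>(-,F-) : \<A> \<rightarrow> \<B>\<close> and \<open>\<B>(F-,-) : \<B> \<rightarrow> \<A>\<close> of a functor \<open>F : \<A> \<rightarrow> \<B>\<close>.\<close>

definition graph :: "('a, 'o, 'm) qcat \<Rightarrow> ('b, 'o, 'm) qcat \<Rightarrow> ('a \<Rightarrow> 'b) \<Rightarrow> 'b \<Rightarrow> 'a \<Rightarrow> 'm" where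
  "graph A B F = (\<lambda>b\<in>Ob B. \<lambda>a\<in>Ob A. Hm B b (F a))"

definition cograph :: "('a, 'o, 'm) qcat \<Rightarrow> ('b, 'o, 'm) qcat \<Rightarrow> ('a \<Rightarrow> 'b) \<Rightarrow> 'a \<Rightarrow> 'b \<Rightarrow> 'm" where
  "cograph A B F = (\<lambda>a\<in>Ob A. \<lambda>b\<in>Ob B. Hm B (F a) b)"

definition functor_le :: "('o, 'm) quantaloid_data \<Rightarrow> ('a, 'o, 'm) qcat \<Rightarrow> ('b, 'o, 'm) qcat
    \<Rightarrow> ('a \<Rightarrow> 'b) \<Rightarrow> ('a \<Rightarrow> 'b) \<Rightarrow> bool" where
  "functor_le Q A B F G \<longleftrightarrow> dist_le Q A B (graph A B F) (graph A B G)"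

definition functor_iso :: "('o, 'm) quantaloid_data \<Rightarrow> ('a, 'o, 'm) qcat \<Rightarrow> ('b, 'o, 'm) qcat
    \<Rightarrow> ('a \<Rightarrow> 'b) \<Rightarrow> ('a \<Rightarrow> 'b) \<Rightarrow> bool" where
  "functor_iso Q A B F G \<longleftrightarrow> functor_le Q A B F G \<and> functor_le Q A B G F"

section \<open>Presheaves and weighted colimits\<close>

definition one_object :: "('o, 'm) quantaloid_data \<Rightarrow> 'o \<Rightarrow> (unit, 'o, 'm) qcat" where
  "one_object Q X = \<lparr>Ob = {()}, Ty = (\<lambda>_. X), Hm = (\<lambda>_ _. Idt Q X)\<rparr>"

text \<open>A presheaf \<open>\<phi> : *\<^sub>X \<rightarrow> \<A>\<close> is recorded together with its type \<open>X\<close>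
  (which the matrix does not determine when \<open>\<A>\<close> is empty).\<close>

type_synonym ('a, 'o, 'm) presheaf = "'o \<times> ('a \<Rightarrow> unit \<Rightarrow> 'm)"

definition presheaves :: "('o, 'm) quantaloid_data \<Rightarrow> ('a, 'o, 'm) qcat
    \<Rightarrow> ('a, 'o, 'm) presheaf set" where
  "presheaves Q A = {(X, \<phi>). X \<in> Obj Q \<and> distributor Q (one_object Q X) A \<phi>}"

definition PSh :: "('o, 'm) quantaloid_data \<Rightarrow> ('a, 'o, 'm) qcat
    \<Rightarrow> (('a, 'o, 'm) presheaf, 'o, 'm) qcat" where
  "PSh Q A = \<lparr>Ob = presheaves Q A,
     Ty = (\<lambda>\<phi>\<in>presheaves Q A. fst \<phi>),
     Hm = (\<lambda>\<psi>\<in>presheaves Q A. \<lambda>\<phi>\<in>presheaves Q A.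
       lifting Q (one_object Q (fst \<phi>)) (one_object Q (fst \<psi>)) A (snd \<psi>) (snd \<phi>) () ())\<rparr>"

definition yoneda :: "('a, 'o, 'm) qcat \<Rightarrow> 'a \<Rightarrow> ('a, 'o, 'm) presheaf" where
  "yoneda A = (\<lambda>a\<in>Ob A. (Ty A a, \<lambda>a'\<in>Ob A. \<lambda>_. Hm A a' a))"

definition PSh_map :: "('o, 'm) quantaloid_data \<Rightarrow> ('a, 'o, 'm) qcat \<Rightarrow> ('b, 'o, 'm) qcat
    \<Rightarrow> ('a \<Rightarrow> 'b) \<Rightarrow> ('a, 'o, 'm) presheaf \<Rightarrow> ('b, 'o, 'm) presheaf" where
  "PSh_map Q A B F = (\<lambda>\<phi>\<in>presheaves Q A.
     (fst \<phi>, dist_comp Q (one_object Q (fst \<phi>)) A B (graph A B F) (snd \<phi>)))"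

definition is_colim :: "('o, 'm) quantaloid_data \<Rightarrow> ('a, 'o, 'm) qcat \<Rightarrow> ('b, 'o, 'm) qcat
    \<Rightarrow> ('a, 'o, 'm) presheaf \<Rightarrow> ('a \<Rightarrow> 'b) \<Rightarrow> 'b \<Rightarrow> bool" where
  "is_colim Q A B \<phi> F c \<longleftrightarrow>
     c \<in> Ob B \<and> Ty B c = fst \<phi> \<and>
     (\<forall>b\<in>Ob B. Hm B c b = lifting Q B (one_object Q (fst \<phi>)) A (snd \<phi>) (cograph A B F) () b)"

text \<open>Colimits are determined up to isomorphism; in \<^term>\<open>PSh Q B\<close> they exist and are unique.\<close>

definition colim :: "('o, 'm) quantaloid_data \<Rightarrow> ('a, 'o, 'm) qcat \<Rightarrow> ('b, 'o, 'm) qcat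
    \<Rightarrow> ('a, 'o, 'm) presheaf \<Rightarrow> ('a \<Rightarrow> 'b) \<Rightarrow> 'b" where
  "colim Q A B \<phi> F = (SOME c. is_colim Q A B \<phi> F c)"

definition PSh_mult :: "('o, 'm) quantaloid_data \<Rightarrow> ('a, 'o, 'm) qcat
    \<Rightarrow> (('a, 'o, 'm) presheaf, 'o, 'm) presheaf \<Rightarrow> ('a, 'o, 'm) presheaf" where
  "PSh_mult Q A = (\<lambda>\<Theta>\<in>presheaves Q (PSh Q A).
     colim Q (PSh Q A) (PSh Q A) \<Theta> (id_functor (PSh Q A)))"

section \<open>The 2-category \<open>Cat(Q)\<close> and classes of presheaves\<close>

text \<open>The objects of \<open>Cat(Q)\<close> are the \<open>Q\<close>-categories whose objects are elements of a type
  \<open>'u\<close> and form a small set. The predicate \<open>small\<close> is an arbitrary parameter: the intended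
  instance takes for \<open>'u\<close> a universe of sets (such as the type \<open>V\<close> of ZFC in HOL) and for \<open>small\<close>
  the subsets of \<open>'u\<close> that are sets in that universe, but no property of \<open>small\<close> is needed.

  \<open>PSh Q A\<close> is not forced back into \<open>'u\<close>: its objects are the presheaves themselves, of a
  different HOL type. All notions above are polymorphic in the types of objects, so that
  \<open>PSh\<close> can be iterated and components \<open>\<epsilon> A : T A \<rightarrow> PSh Q A\<close> be stated without coding presheaves
  as elements of \<open>'u\<close>.\<close>

definition QCat :: "('u set \<Rightarrow> bool) \<Rightarrow> ('o, 'm) quantaloid_data \<Rightarrow> ('u, 'o, 'm) qcat set" where
  "QCat small Q = {A. qcategory Q A \<and> small (Ob A)}"

text \<open>A class of presheaves consists of pairs of a \<open>Q\<close>-category and a presheaf on it.\<close>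

type_synonym ('u, 'o, 'm) presheaf_class = "(('u, 'o, 'm) qcat \<times> ('u, 'o, 'm) presheaf) set"

definition presheaf_class :: "('u set \<Rightarrow> bool) \<Rightarrow> ('o, 'm) quantaloid_data
    \<Rightarrow> ('u, 'o, 'm) presheaf_class \<Rightarrow> bool" where
  "presheaf_class small Q \<C> \<longleftrightarrow> \<C> \<subseteq> (SIGMA A : QCat small Q. presheaves Q A)"

definition saturated :: "('u set \<Rightarrow> bool) \<Rightarrow> ('o, 'm) quantaloid_data
    \<Rightarrow> ('u, 'o, 'm) presheaf_class \<Rightarrow> bool" where
  "saturated small Q \<C> \<longleftrightarrow>
     presheaf_class small Q \<C> \<and>
     (\<forall>A\<in>QCat small Q. \<forall>a\<in>Ob A. (A, yoneda A a) \<in> \<C>) \<and>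
     (\<forall>A \<phi>. \<forall>B\<in>QCat small Q. \<forall>G. (A, \<phi>) \<in> \<C> \<and> qfunctor Q A (PSh Q B) G \<and>
        (\<forall>a\<in>Ob A. (B, G a) \<in> \<C>) \<longrightarrow> (B, colim Q A (PSh Q B) \<phi> G) \<in> \<C>)"

definition cocomplete :: "('u set \<Rightarrow> bool) \<Rightarrow> ('o, 'm) quantaloid_data
    \<Rightarrow> ('u, 'o, 'm) presheaf_class \<Rightarrow> ('u, 'o, 'm) qcat \<Rightarrow> bool" where
  "cocomplete small Q \<C> B \<longleftrightarrow>
     B \<in> QCat small Q \<and>
     (\<forall>A \<phi> F. (A, \<phi>) \<in> \<C> \<and> qfunctor Q A B F \<longrightarrow> (\<exists>c. is_colim Q A B \<phi> F c))"

definition cocontinuous :: "('o, 'm) quantaloid_data \<Rightarrow> ('u, 'o, 'm) presheaf_class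
    \<Rightarrow> ('u, 'o, 'm) qcat \<Rightarrow> ('u, 'o, 'm) qcat \<Rightarrow> ('u \<Rightarrow> 'u) \<Rightarrow> bool" where
  "cocontinuous Q \<C> B B' G \<longleftrightarrow>
     qfunctor Q B B' G \<and>
     (\<forall>A \<phi> F c. (A, \<phi>) \<in> \<C> \<and> qfunctor Q A B F \<and> is_colim Q A B \<phi> F c
        \<longrightarrow> is_colim Q A B' \<phi> (comp_functor A G F) (G c))"

section \<open>Full sub-KZ-doctrines and their algebras\<close>

text \<open>A 2-functor on \<open>Cat(Q)\<close> is given by its action \<open>T\<close> on objects and \<open>T\<^sub>1\<close> on functors, the
  latter indexed by domain and codomain since a HOL function does not determine these.
  All equations between functors, including functoriality of \<open>T\<^sub>1\<close>, are understood up to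
  \<^const>\<open>functor_iso\<close>.\<close>

type_synonym ('u, 'o, 'm) obj_map = "('u, 'o, 'm) qcat \<Rightarrow> ('u, 'o, 'm) qcat"
type_synonym ('u, 'o, 'm) fun_map =
  "('u, 'o, 'm) qcat \<Rightarrow> ('u, 'o, 'm) qcat \<Rightarrow> ('u \<Rightarrow> 'u) \<Rightarrow> 'u \<Rightarrow> 'u"

definition two_functor :: "('u set \<Rightarrow> bool) \<Rightarrow> ('o, 'm) quantaloid_data
    \<Rightarrow> ('u, 'o, 'm) obj_map \<Rightarrow> ('u, 'o, 'm) fun_map \<Rightarrow> bool" where
  "two_functor small Q T T\<^sub>1 \<longleftrightarrow>
     (\<forall>A\<in>QCat small Q. T A \<in> QCat small Q) \<and>
     (\<forall>A\<in>QCat small Q. \<forall>B\<in>QCat small Q. \<forall>F.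
        qfunctor Q A B F \<longrightarrow> qfunctor Q (T A) (T B) (T\<^sub>1 A B F)) \<and>
     (\<forall>A\<in>QCat small Q. \<forall>B\<in>QCat small Q. \<forall>F G.
        qfunctor Q A B F \<and> qfunctor Q A B G \<and> functor_le Q A B F G
        \<longrightarrow> functor_le Q (T A) (T B) (T\<^sub>1 A B F) (T\<^sub>1 A B G)) \<and>
     (\<forall>A\<in>QCat small Q. functor_iso Q (T A) (T A) (T\<^sub>1 A A (id_functor A)) (id_functor (T A))) \<and>
     (\<forall>A\<in>QCat small Q. \<forall>B\<in>QCat small Q. \<forall>C\<in>QCat small Q. \<forall>F G.
        qfunctor Q A B F \<and> qfunctor Q B C G
        \<longrightarrow> functor_iso Q (T A) (T C) (T\<^sub>1 A C (comp_functor A G F))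
              (comp_functor (T A) (T\<^sub>1 B C G) (T\<^sub>1 A B F)))"

text \<open>2-naturality is naturality: the 2-categories involved are locally ordered.\<close>

definition natural_to_PSh :: "('u set \<Rightarrow> bool) \<Rightarrow> ('o, 'm) quantaloid_data
    \<Rightarrow> ('u, 'o, 'm) obj_map \<Rightarrow> ('u, 'o, 'm) fun_map
    \<Rightarrow> (('u, 'o, 'm) qcat \<Rightarrow> 'u \<Rightarrow> ('u, 'o, 'm) presheaf) \<Rightarrow> bool" where
  "natural_to_PSh small Q T T\<^sub>1 \<epsilon> \<longleftrightarrow>
     (\<forall>A\<in>QCat small Q. qfunctor Q (T A) (PSh Q A) (\<epsilon> A)) \<and>
     (\<forall>A\<in>QCat small Q. \<forall>B\<in>QCat small Q. \<forall>F. qfunctor Q A B F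
        \<longrightarrow> functor_iso Q (T A) (PSh Q B)
              (comp_functor (T A) (PSh_map Q A B F) (\<epsilon> A))
              (comp_functor (T A) (\<epsilon> B) (T\<^sub>1 A B F)))"

definition eps_square :: "('o, 'm) quantaloid_data \<Rightarrow> ('u, 'o, 'm) obj_map
    \<Rightarrow> (('u, 'o, 'm) qcat \<Rightarrow> 'u \<Rightarrow> ('u, 'o, 'm) presheaf)
    \<Rightarrow> ('u, 'o, 'm) qcat \<Rightarrow> 'u \<Rightarrow> (('u, 'o, 'm) presheaf, 'o, 'm) presheaf" where
  "eps_square Q T \<epsilon> A =
     comp_functor (T (T A)) (PSh_map Q (T A) (PSh Q A) (\<epsilon> A)) (\<epsilon> (T A))"

definition mult_factorisation :: "('u set \<Rightarrow> bool) \<Rightarrow> ('o, 'm) quantaloid_data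
    \<Rightarrow> ('u, 'o, 'm) obj_map \<Rightarrow> (('u, 'o, 'm) qcat \<Rightarrow> 'u \<Rightarrow> ('u, 'o, 'm) presheaf)
    \<Rightarrow> (('u, 'o, 'm) qcat \<Rightarrow> 'u \<Rightarrow> 'u) \<Rightarrow> bool" where
  "mult_factorisation small Q T \<epsilon> \<mu> \<longleftrightarrow>
     (\<forall>A\<in>QCat small Q. qfunctor Q (T (T A)) (T A) (\<mu> A) \<and>
        functor_iso Q (T (T A)) (PSh Q A)
          (comp_functor (T (T A)) (PSh_mult Q A) (eps_square Q T \<epsilon> A))
          (comp_functor (T (T A)) (\<epsilon> A) (\<mu> A)))"

definition unit_factorisation :: "('u set \<Rightarrow> bool) \<Rightarrow> ('o, 'm) quantaloid_data
    \<Rightarrow> ('u, 'o, 'm) obj_map \<Rightarrow> (('u, 'o, 'm) qcat \<Rightarrow> 'u \<Rightarrow> ('u, 'o, 'm) presheaf)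
    \<Rightarrow> (('u, 'o, 'm) qcat \<Rightarrow> 'u \<Rightarrow> 'u) \<Rightarrow> bool" where
  "unit_factorisation small Q T \<epsilon> \<eta> \<longleftrightarrow>
     (\<forall>A\<in>QCat small Q. qfunctor Q A (T A) (\<eta> A) \<and>
        functor_iso Q A (PSh Q A) (yoneda A) (comp_functor A (\<epsilon> A) (\<eta> A)))"

definition full_sub_KZ_doctrine :: "('u set \<Rightarrow> bool) \<Rightarrow> ('o, 'm) quantaloid_data
    \<Rightarrow> ('u, 'o, 'm) obj_map \<Rightarrow> ('u, 'o, 'm) fun_map
    \<Rightarrow> (('u, 'o, 'm) qcat \<Rightarrow> 'u \<Rightarrow> ('u, 'o, 'm) presheaf) \<Rightarrow> bool" where
  "full_sub_KZ_doctrine small Q T T\<^sub>1 \<epsilon> \<longleftrightarrow>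
     two_functor small Q T T\<^sub>1 \<and>
     natural_to_PSh small Q T T\<^sub>1 \<epsilon> \<and>
     (\<forall>A\<in>QCat small Q. fully_faithful (T A) (PSh Q A) (\<epsilon> A)) \<and>
     (\<exists>\<mu>. mult_factorisation small Q T \<epsilon> \<mu>) \<and>
     (\<exists>\<eta>. unit_factorisation small Q T \<epsilon> \<eta>)"

definition is_algebra :: "('u set \<Rightarrow> bool) \<Rightarrow> ('o, 'm) quantaloid_data
    \<Rightarrow> ('u, 'o, 'm) obj_map \<Rightarrow> ('u, 'o, 'm) fun_map
    \<Rightarrow> (('u, 'o, 'm) qcat \<Rightarrow> 'u \<Rightarrow> 'u) \<Rightarrow> (('u, 'o, 'm) qcat \<Rightarrow> 'u \<Rightarrow> 'u)
    \<Rightarrow> ('u, 'o, 'm) qcat \<Rightarrow> ('u \<Rightarrow> 'u) \<Rightarrow> bool" where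
  "is_algebra small Q T T\<^sub>1 \<mu> \<eta> B L \<longleftrightarrow>
     B \<in> QCat small Q \<and> qfunctor Q (T B) B L \<and>
     functor_iso Q B B (comp_functor B L (\<eta> B)) (id_functor B) \<and>
     functor_iso Q (T (T B)) B (comp_functor (T (T B)) L (\<mu> B))
       (comp_functor (T (T B)) L (T\<^sub>1 (T B) B L))"

definition is_algebra_hom :: "('o, 'm) quantaloid_data
    \<Rightarrow> ('u, 'o, 'm) obj_map \<Rightarrow> ('u, 'o, 'm) fun_map
    \<Rightarrow> ('u, 'o, 'm) qcat \<Rightarrow> ('u \<Rightarrow> 'u) \<Rightarrow> ('u, 'o, 'm) qcat \<Rightarrow> ('u \<Rightarrow> 'u)
    \<Rightarrow> ('u \<Rightarrow> 'u) \<Rightarrow> bool" where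
  "is_algebra_hom Q T T\<^sub>1 B L B' L' G \<longleftrightarrow>
     qfunctor Q B B' G \<and>
     functor_iso Q (T B) B' (comp_functor (T B) G L) (comp_functor (T B) L' (T\<^sub>1 B B' G))"

definition doctrine_class :: "('u set \<Rightarrow> bool) \<Rightarrow> ('o, 'm) quantaloid_data
    \<Rightarrow> ('u, 'o, 'm) obj_map \<Rightarrow> (('u, 'o, 'm) qcat \<Rightarrow> 'u \<Rightarrow> ('u, 'o, 'm) presheaf)
    \<Rightarrow> ('u, 'o, 'm) presheaf_class" where
  "doctrine_class small Q T \<epsilon> = {(A, \<epsilon> A t) | A t. A \<in> QCat small Q \<and> t \<in> Ob (T A)}"

end

theory Submission
  imports Defs
begin

text \<open>Presheaf categories are skeletal, so every isomorphism of functors into one of them is an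
  equality, and naturality and the two factorisations become identities between presheaves:
  \<open>\<epsilon> B (T\<^sub>1 F t) = PSh_map F (\<epsilon> A t)\<close>, \<open>\<epsilon> A (\<eta> A a) = yoneda A a\<close>, and \<open>\<epsilon> A (\<mu> A s)\<close> is the
  colimit of \<open>\<epsilon> A\<close> weighted by \<open>\<epsilon> (T A) s\<close>. Together with the change of weight
  \<open>colim (PSh_map H \<phi>) F = colim \<phi> (F \<circ> H)\<close> they reduce everything to colimits: a structure map \<open>L\<close>
  is an algebra if and only if \<open>L t\<close> is the colimit of the identity weighted by \<open>\<epsilon> B t\<close>, and
  then \<open>L (T\<^sub>1 F t)\<close> is the colimit of \<open>F\<close> weighted by \<open>\<epsilon> A t\<close>.\<close>

section \<open>Hom-lattices\<close>

context quantaloid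
begin

lemma Hom_Obj:
  assumes "f \<in> Hom Q X Y"
  shows "X \<in> Obj Q" "Y \<in> Obj Q"
  using assms Dom_Obj Cod_Obj by (auto simp: Hom_def)

lemma Leq_refl: "f \<in> Hom Q X Y \<Longrightarrow> f \<preceq> f"
proof -
  assume f: "f \<in> Hom Q X Y"
  interpret complete_lattice "hom_lattice Q X Y"
    using f by (intro hom_complete Hom_Obj)
  show ?thesis using f le_refl[of f] by (simp add: hom_lattice_def)
qed

lemma Leq_trans:
  "\<lbrakk>f \<preceq> g; g \<preceq> h; f \<in> Hom Q X Y; g \<in> Hom Q X Y; h \<in> Hom Q X Y\<rbrakk> \<Longrightarrow> f \<preceq> h"
proof -
  assume *: "f \<preceq> g" "g \<preceq> h" "f \<in> Hom Q X Y" "g \<in> Hom Q X Y" "h \<in> Hom Q X Y"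
  interpret complete_lattice "hom_lattice Q X Y"
    using *(3) by (intro hom_complete Hom_Obj)
  show ?thesis using * le_trans[of f g h] by (simp add: hom_lattice_def)
qed

lemma Leq_antisym: "\<lbrakk>f \<preceq> g; g \<preceq> f; f \<in> Hom Q X Y; g \<in> Hom Q X Y\<rbrakk> \<Longrightarrow> f = g"
proof -
  assume *: "f \<preceq> g" "g \<preceq> f" "f \<in> Hom Q X Y" "g \<in> Hom Q X Y"
  interpret complete_lattice "hom_lattice Q X Y"
    using *(3) by (intro hom_complete Hom_Obj)
  show ?thesis using * le_antisym[of f g] by (simp add: hom_lattice_def)
qed

text \<open>Liftings are known only through the arrows below them, so equations with them are proved
  by comparing lower sets.\<close>

lemma eq_if_same_lower:
  assumes "x \<in> Hom Q X Y" "y \<in> Hom Q X Y" "\<And>f. f \<in> Hom Q X Y \<Longrightarrow> f \<preceq> x \<longleftrightarrow> f \<preceq> y"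
  shows "x = y"
  using assms Leq_refl Leq_antisym by blast

section \<open>Joins and their universal property\<close>

lemma Join_Hom:
  assumes "X \<in> Obj Q" "Y \<in> Obj Q" "S \<subseteq> Hom Q X Y"
  shows "Join Q X Y S \<in> Hom Q X Y"
proof -
  interpret complete_lattice "hom_lattice Q X Y" using assms by (intro hom_complete)
  show ?thesis using sup_closed[of S] assms by (simp add: hom_lattice_def Join_def)
qed

lemma Join_upper:
  assumes "S \<subseteq> Hom Q X Y" "f \<in> S"
  shows "f \<preceq> Join Q X Y S"
proof -
  interpret complete_lattice "hom_lattice Q X Y"
    using assms Hom_Obj by (intro hom_complete) blast+
  show ?thesis using sup_upper[of S f] assms by (simp add: hom_lattice_def Join_def)
qed

lemma Join_least:
  assumes "S \<subseteq> Hom Q X Y" "g \<in> Hom Q X Y" "\<And>f. f \<in> S \<Longrightarrow> f \<preceq> g"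
  shows "Join Q X Y S \<preceq> g"
proof -
  interpret complete_lattice "hom_lattice Q X Y"
    using assms Hom_Obj by (intro hom_complete) blast+
  have "Lattice.sup (hom_lattice Q X Y) S \<sqsubseteq>\<^bsub>hom_lattice Q X Y\<^esub> g"
    using assms by (intro sup_least) (auto simp: hom_lattice_def Upper_def)
  then show ?thesis by (simp add: hom_lattice_def Join_def)
qed

lemma Join_le_iff:
  assumes "S \<subseteq> Hom Q X Y" "g \<in> Hom Q X Y"
  shows "Join Q X Y S \<preceq> g \<longleftrightarrow> (\<forall>f\<in>S. f \<preceq> g)"
proof
  assume *: "Join Q X Y S \<preceq> g"
  show "\<forall>f\<in>S. f \<preceq> g"
  proof
    fix f assume "f \<in> S"
    then show "f \<preceq> g"
      using assms * Join_upper[of S X Y f] Join_Hom Hom_Obj[of g X Y] Leq_trans[of f "Join Q X Y S" g X Y]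
      by blast
  qed
qed (use assms Join_least in blast)

text \<open>Expresses the order through a join, so that preservation of joins yields monotonicity of
  composition.\<close>

lemma Join_insert_le:
  assumes "f \<preceq> g" "f \<in> Hom Q X Y" "g \<in> Hom Q X Y"
  shows "Join Q X Y {f, g} = g"
proof (rule Leq_antisym)
  show "Join Q X Y {f, g} \<in> Hom Q X Y" using assms Join_Hom Hom_Obj by (metis empty_subsetI insert_subset)
qed (use assms Leq_refl in \<open>auto intro!: Join_least Join_upper\<close>)

section \<open>Composition against the order and against joins\<close>

text \<open>Composition preserves the join of \<open>{f, f'}\<close>, which is \<open>f'\<close>,
  and \<open>g \<cdot> f\<close> is one of the joined arrows.\<close>

lemma Cmp_mono_right:
  assumes "f \<preceq> f'" "f \<in> Hom Q X Y" "f' \<in> Hom Q X Y" "g \<in> Hom Q Y Z"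
  shows "g \<cdot> f \<preceq> g \<cdot> f'"
proof -
  have "g \<cdot> f' = Join Q X Z ((\<lambda>f. g \<cdot> f) ` {f, f'})"
    using assms Hom_Obj Cmp_Join_right[of X Y Z g "{f, f'}"] by (auto simp: Join_insert_le)
  moreover have "g \<cdot> f \<preceq> Join Q X Z ((\<lambda>f. g \<cdot> f) ` {f, f'})"
    using assms Cmp_Hom by (intro Join_upper) auto
  ultimately show ?thesis by simp
qed

lemma Cmp_mono_left:
  assumes "g \<preceq> g'" "g \<in> Hom Q Y Z" "g' \<in> Hom Q Y Z" "f \<in> Hom Q X Y"
  shows "g \<cdot> f \<preceq> g' \<cdot> f"
proof -
  have "g' \<cdot> f = Join Q X Z ((\<lambda>g. g \<cdot> f) ` {g, g'})"
    using assms Hom_Obj Cmp_Join_left[of X Y Z "{g, g'}" f] by (auto simp: Join_insert_le)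
  moreover have "g \<cdot> f \<preceq> Join Q X Z ((\<lambda>g. g \<cdot> f) ` {g, g'})"
    using assms Cmp_Hom by (intro Join_upper) auto
  ultimately show ?thesis by simp
qed

lemma Cmp_le_trans_right:
  assumes "f \<preceq> f'" "g \<cdot> f' \<preceq> h"
    "f \<in> Hom Q X Y" "f' \<in> Hom Q X Y" "g \<in> Hom Q Y Z" "h \<in> Hom Q X Z"
  shows "g \<cdot> f \<preceq> h"
  using Leq_trans[OF Cmp_mono_right[OF assms(1,3-5)] assms(2) Cmp_Hom[OF assms(3,5)]
      Cmp_Hom[OF assms(4,5)] assms(6)] .

lemma Cmp_le_trans_left:
  assumes "g \<preceq> g'" "g' \<cdot> f \<preceq> h"
    "g \<in> Hom Q Y Z" "g' \<in> Hom Q Y Z" "f \<in> Hom Q X Y" "h \<in> Hom Q X Z"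
  shows "g \<cdot> f \<preceq> h"
  using Leq_trans[OF Cmp_mono_left[OF assms(1,3-5)] assms(2) Cmp_Hom[OF assms(5,3)]
      Cmp_Hom[OF assms(5,4)] assms(6)] .

text \<open>Distributivity followed by the universal property of the join: a join inside a composite
  is tested on its members.\<close>

lemma Join_Cmp_le_iff:
  assumes "X \<in> Obj Q" "Y \<in> Obj Q" "Z \<in> Obj Q" "S \<subseteq> Hom Q Y Z" "f \<in> Hom Q X Y" "h \<in> Hom Q X Z"
  shows "Join Q Y Z S \<cdot> f \<preceq> h \<longleftrightarrow> (\<forall>g\<in>S. g \<cdot> f \<preceq> h)"
proof -
  have "(\<lambda>g. g \<cdot> f) ` S \<subseteq> Hom Q X Z" using assms(4) Cmp_Hom[OF assms(5)] by auto
  then show ?thesis using Cmp_Join_left[OF assms(1-5)] Join_le_iff[OF _ assms(6)] by simp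
qed

lemma Cmp_Join_le_iff:
  assumes "X \<in> Obj Q" "Y \<in> Obj Q" "Z \<in> Obj Q" "S \<subseteq> Hom Q X Y" "g \<in> Hom Q Y Z" "h \<in> Hom Q X Z"
  shows "g \<cdot> Join Q X Y S \<preceq> h \<longleftrightarrow> (\<forall>f\<in>S. g \<cdot> f \<preceq> h)"
proof -
  have "(\<lambda>f. g \<cdot> f) ` S \<subseteq> Hom Q X Z" using assms(4) Cmp_Hom[OF _ assms(5)] by auto
  then show ?thesis using Cmp_Join_right[OF assms(1-3,5,4)] Join_le_iff[OF _ assms(6)] by simp
qed

section \<open>Categories and distributors\<close>

lemma Ty_Obj: "\<lbrakk>qcategory Q A; a \<in> Ob A\<rbrakk> \<Longrightarrow> Ty A a \<in> Obj Q"
  by (auto simp: qcategory_def)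

lemma Hm_Hom: "\<lbrakk>qcategory Q A; a' \<in> Ob A; a \<in> Ob A\<rbrakk> \<Longrightarrow> Hm A a' a \<in> Hom Q (Ty A a) (Ty A a')"
  by (fastforce simp: qcategory_def PiE_iff)

lemma Hm_Idt: "\<lbrakk>qcategory Q A; a \<in> Ob A\<rbrakk> \<Longrightarrow> Idt Q (Ty A a) \<preceq> Hm A a a"
  by (auto simp: qcategory_def)

lemma Hm_Cmp: "\<lbrakk>qcategory Q A; a'' \<in> Ob A; a' \<in> Ob A; a \<in> Ob A\<rbrakk>
    \<Longrightarrow> Hm A a'' a' \<cdot> Hm A a' a \<preceq> Hm A a'' a"
  by (auto simp: qcategory_def)

lemma Hm_Cmp_le:
  assumes "qcategory Q A" "a'' \<in> Ob A" "a' \<in> Ob A" "a \<in> Ob A"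
    "g \<preceq> Hm A a'' a'" "f \<preceq> Hm A a' a"
    "g \<in> Hom Q (Ty A a') (Ty A a'')" "f \<in> Hom Q (Ty A a) (Ty A a')"
  shows "g \<cdot> f \<preceq> Hm A a'' a"
  using Cmp_le_trans_left[OF assms(5) Cmp_le_trans_right[OF assms(6) Hm_Cmp[OF assms(1-4)]]]
    assms Hm_Hom[OF assms(1)] by blast

lemma le_Hm_Cmp_self:
  assumes "qcategory Q A" "a \<in> Ob A" "f \<in> Hom Q X (Ty A a)"
  shows "f \<preceq> Hm A a a \<cdot> f"
  using Cmp_mono_left[OF Hm_Idt[OF assms(1,2)] Idt_Hom[OF Ty_Obj[OF assms(1,2)]]
      Hm_Hom[OF assms(1,2,2)] assms(3)]
  by (simp add: Cmp_Idt_left[OF assms(3)])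

lemma one_object_simps [simp]:
  "Ob (one_object Q X) = {()}" "Ty (one_object Q X) u = X" "Hm (one_object Q X) u v = Idt Q X"
  by (simp_all add: one_object_def)

lemma qcategory_one_object: "X \<in> Obj Q \<Longrightarrow> qcategory Q (one_object Q X)"
  using Idt_Hom[of X] Leq_refl[OF Idt_Hom[of X]] Cmp_Idt_left[OF Idt_Hom[of X]]
  by (auto simp: qcategory_def PiE_iff extensional_def)

section \<open>Distributors and liftings along a presheaf\<close>

lemma dist_Hom:
  "\<lbrakk>distributor Q A B \<Phi>; b \<in> Ob B; a \<in> Ob A\<rbrakk> \<Longrightarrow> \<Phi> b a \<in> Hom Q (Ty A a) (Ty B b)"
  by (fastforce simp: distributor_def PiE_iff)

lemma dist_act_right: "\<lbrakk>distributor Q A B \<Phi>; b \<in> Ob B; a' \<in> Ob A; a \<in> Ob A\<rbrakk>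
    \<Longrightarrow> \<Phi> b a' \<cdot> Hm A a' a \<preceq> \<Phi> b a"
  by (auto simp: distributor_def)

lemma dist_act_left: "\<lbrakk>distributor Q A B \<Phi>; b \<in> Ob B; b' \<in> Ob B; a \<in> Ob A\<rbrakk>
    \<Longrightarrow> Hm B b b' \<cdot> \<Phi> b' a \<preceq> \<Phi> b a"
  by (auto simp: distributor_def)

text \<open>The lifting is computed pointwise: at \<open>d\<close> it is the largest
  \<open>f\<close> with every \<open>\<psi> a () \<cdot> f\<close> below \<open>\<Phi> a d\<close>,
  which exists because composition preserves joins. The homs of \<open>PSh Q A\<close> and the
  universal property of weighted colimits are both read off from the second claim.\<close>

lemma lifting_presheaf:
  assumes D: "qcategory Q D" and A: "qcategory Q A" and X: "X \<in> Obj Q"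
    and psi: "distributor Q (one_object Q X) A \<psi>" and Phi: "distributor Q D A \<Phi>"
    and d: "d \<in> Ob D"
  shows "lifting Q D (one_object Q X) A \<psi> \<Phi> () d \<in> Hom Q (Ty D d) X" (is ?thesis1)
    and "f \<in> Hom Q (Ty D d) X \<Longrightarrow> f \<preceq> lifting Q D (one_object Q X) A \<psi> \<Phi> () d
      \<longleftrightarrow> (\<forall>a\<in>Ob A. \<psi> a () \<cdot> f \<preceq> \<Phi> a d)" (is "_ \<Longrightarrow> ?thesis2")
proof -
  \<comment> \<open>The candidate for the lifting is the join of all arrows admissible at
    \<open>d\<close>.\<close>
  define S where "S d = {f \<in> Hom Q (Ty D d) X. \<forall>a\<in>Ob A. \<psi> a () \<cdot> f \<preceq> \<Phi> a d}" for d
  define \<Theta> where "\<Theta> = (\<lambda>u\<in>{()}. \<lambda>d\<in>Ob D. Join Q (Ty D d) X (S d))"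
  have S: "S d \<subseteq> Hom Q (Ty D d) X" for d by (auto simp: S_def)
  have \<psi>H: "\<psi> a () \<in> Hom Q X (Ty A a)" if "a \<in> Ob A" for a
    using dist_Hom[OF psi that, of "()"] by simp
  have \<Phi>H: "\<Phi> a d \<in> Hom Q (Ty D d) (Ty A a)" if "a \<in> Ob A" "d \<in> Ob D" for a d
    using dist_Hom[OF Phi that] .
  have \<Theta>H: "\<Theta> () d \<in> Hom Q (Ty D d) X" if "d \<in> Ob D" for d
    using that X S by (auto simp: \<Theta>_def intro!: Join_Hom Ty_Obj[OF D])
  have \<Theta>_below: "\<psi> a () \<cdot> \<Theta> () d \<preceq> \<Phi> a d" if "a \<in> Ob A" "d \<in> Ob D" for a d
    using Cmp_Join_le_iff[OF Ty_Obj[OF D that(2)] X Ty_Obj[OF A that(1)] S \<psi>H[OF that(1)] \<Phi>H[OF that]] that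
    by (auto simp: \<Theta>_def S_def)
  have \<Theta>_iff: "f \<preceq> \<Theta> () d \<longleftrightarrow> (\<forall>a\<in>Ob A. \<psi> a () \<cdot> f \<preceq> \<Phi> a d)"
    if "d \<in> Ob D" "f \<in> Hom Q (Ty D d) X" for f d
  proof
    assume "f \<preceq> \<Theta> () d"
    then show "\<forall>a\<in>Ob A. \<psi> a () \<cdot> f \<preceq> \<Phi> a d"
      using Cmp_le_trans_right[OF _ \<Theta>_below _ \<Theta>H \<psi>H \<Phi>H] that by blast
  next
    assume "\<forall>a\<in>Ob A. \<psi> a () \<cdot> f \<preceq> \<Phi> a d"
    then show "f \<preceq> \<Theta> () d"
      using that S by (auto simp: \<Theta>_def S_def intro!: Join_upper)
  qed
  have dist: "distributor Q D (one_object Q X) \<Theta>"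
    unfolding distributor_def
  proof (intro conjI ballI)
    show "\<Theta> \<in> (\<Pi>\<^sub>E b\<in>Ob (one_object Q X). \<Pi>\<^sub>E a\<in>Ob D. Hom Q (Ty D a) (Ty (one_object Q X) b))"
      using \<Theta>H by (auto simp: \<Theta>_def PiE_iff extensional_def)
  next
    fix u d' d assume *: "u \<in> Ob (one_object Q X)" "d' \<in> Ob D" "d \<in> Ob D"
    \<comment> \<open>By \<open>\<Theta>_iff\<close> it suffices to compose with
      \<open>\<psi> a ()\<close>; after reassociating, the right action of \<open>D\<close> on
      \<Phi> finishes.\<close>
    have "\<Theta> () d' \<cdot> Hm D d' d \<preceq> \<Theta> () d"
    proof (subst \<Theta>_iff)
      show "\<Theta> () d' \<cdot> Hm D d' d \<in> Hom Q (Ty D d) X" using * Cmp_Hom \<Theta>H Hm_Hom[OF D] by blast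
      show "\<forall>a\<in>Ob A. \<psi> a () \<cdot> (\<Theta> () d' \<cdot> Hm D d' d) \<preceq> \<Phi> a d"
      proof
        fix a assume a: "a \<in> Ob A"
        have "(\<psi> a () \<cdot> \<Theta> () d') \<cdot> Hm D d' d \<preceq> \<Phi> a d"
          using Cmp_le_trans_left[OF \<Theta>_below[OF a *(2)] dist_act_right[OF Phi a *(2,3)]]
            a * Cmp_Hom \<Theta>H \<psi>H \<Phi>H Hm_Hom[OF D] by blast
        then show "\<psi> a () \<cdot> (\<Theta> () d' \<cdot> Hm D d' d) \<preceq> \<Phi> a d"
          using Cmp_assoc[OF Hm_Hom[OF D *(2,3)] \<Theta>H[OF *(2)] \<psi>H[OF a]] by simp
      qed
    qed (use * in simp)
    then show "\<Theta> u d' \<cdot> Hm D d' d \<preceq> \<Theta> u d" by simp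
  next
    fix u v d assume "u \<in> Ob (one_object Q X)" "v \<in> Ob (one_object Q X)" "d \<in> Ob D"
    then show "Hm (one_object Q X) u v \<cdot> \<Theta> v d \<preceq> \<Theta> u d"
      using Cmp_Idt_left[OF \<Theta>H] Leq_refl[OF \<Theta>H] by simp
  qed
  \<comment> \<open>A composite through the one-object category is a join over a single index, so
    the lifting condition splits into the inequalities that \<open>\<Theta>_iff\<close>
    describes.\<close>
  have comp_iff: "dist_le Q D A (dist_comp Q D (one_object Q X) A \<psi> \<Theta>') \<Phi>
      \<longleftrightarrow> (\<forall>d\<in>Ob D. \<Theta>' () d \<preceq> \<Theta> () d)"
    if "distributor Q D (one_object Q X) \<Theta>'" for \<Theta>'
  proof -
    have H: "\<Theta>' () d \<in> Hom Q (Ty D d) X" if "d \<in> Ob D" for d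
      using dist_Hom[OF \<open>distributor Q D (one_object Q X) \<Theta>'\<close>, of "()" d] that by simp
    have "Join Q (Ty D d) (Ty A a) {\<psi> a () \<cdot> \<Theta>' () d} \<preceq> \<Phi> a d \<longleftrightarrow> \<psi> a () \<cdot> \<Theta>' () d \<preceq> \<Phi> a d"
      if "a \<in> Ob A" "d \<in> Ob D" for a d
      using that Cmp_Hom[OF H \<psi>H] \<Phi>H by (subst Join_le_iff) auto
    then show ?thesis
      using \<Theta>_iff H by (fastforce simp: dist_le_def dist_comp_def)
  qed
  have lift: "is_lifting Q D (one_object Q X) A \<psi> \<Phi> \<Theta>"
    unfolding is_lifting_def using dist comp_iff Leq_refl[OF \<Theta>H] by (auto simp: dist_le_def)
  have "lifting Q D (one_object Q X) A \<psi> \<Phi> = \<Theta>"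
    unfolding lifting_def
  proof (rule the_equality)
    fix \<Theta>' assume l: "is_lifting Q D (one_object Q X) A \<psi> \<Phi> \<Theta>'"
    then have d': "distributor Q D (one_object Q X) \<Theta>'" by (simp add: is_lifting_def)
    show "\<Theta>' = \<Theta>"
    proof (rule ext, rule ext)
      fix u d
      \<comment> \<open>Outside the carrier of \<open>D\<close> both matrices are
        \<open>undefined\<close>, so uniqueness holds as an equality of HOL functions.\<close>
      show "\<Theta>' u d = \<Theta> u d"
      proof (cases "d \<in> Ob D")
        case True
        have "\<Theta>' () d \<preceq> \<Theta> () d" "\<Theta> () d \<preceq> \<Theta>' () d"
          using l lift True by (auto simp: is_lifting_def dist_le_def)
        then show ?thesis
          using Leq_antisym dist_Hom[OF d', of "()" d] True \<Theta>H by auto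
      next
        case False
        then show ?thesis
          using d' dist by (auto simp: distributor_def PiE_iff extensional_def)
      qed
    qed
  qed (rule lift)
  then show ?thesis1 "f \<in> Hom Q (Ty D d) X \<Longrightarrow> ?thesis2"
    using \<Theta>H \<Theta>_iff d by simp_all
qed

section \<open>Presheaves\<close>

lemma presheaf_Obj: "\<phi> \<in> presheaves Q A \<Longrightarrow> fst \<phi> \<in> Obj Q"
  by (auto simp: presheaves_def)

lemma presheaf_dist: "\<phi> \<in> presheaves Q A \<Longrightarrow> distributor Q (one_object Q (fst \<phi>)) A (snd \<phi>)"
  by (auto simp: presheaves_def)

lemma presheaf_Hom:
  "\<lbrakk>\<phi> \<in> presheaves Q A; a \<in> Ob A\<rbrakk> \<Longrightarrow> snd \<phi> a () \<in> Hom Q (fst \<phi>) (Ty A a)"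
  using dist_Hom[OF presheaf_dist, of \<phi> A a "()"] by simp

lemma presheaf_act: "\<lbrakk>\<phi> \<in> presheaves Q A; a \<in> Ob A; a' \<in> Ob A\<rbrakk>
    \<Longrightarrow> Hm A a a' \<cdot> snd \<phi> a' () \<preceq> snd \<phi> a ()"
  using dist_act_left[OF presheaf_dist, of \<phi> A a a' "()"] by simp

text \<open>The right action is composition with the identity of the one-object category, so only
  the left action has to be checked.\<close>

lemma presheafI:
  assumes "X \<in> Obj Q" "\<And>a. a \<in> Ob A \<Longrightarrow> p a \<in> Hom Q X (Ty A a)"
    and "\<And>a a'. \<lbrakk>a \<in> Ob A; a' \<in> Ob A\<rbrakk> \<Longrightarrow> Hm A a a' \<cdot> p a' \<preceq> p a"
  shows "(X, \<lambda>a\<in>Ob A. \<lambda>_. p a) \<in> presheaves Q A"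
  using assms Cmp_Idt_right[OF assms(2)] Leq_refl[OF assms(2)]
  by (auto simp: presheaves_def distributor_def PiE_iff extensional_def)

text \<open>Matrices are extensional, hence determined by their values on the carrier. The type is
  compared separately, since over an empty category the matrix does not record it.\<close>

lemma presheaf_eqI:
  assumes "\<phi> \<in> presheaves Q A" "\<psi> \<in> presheaves Q A" "fst \<phi> = fst \<psi>"
    and "\<And>a. a \<in> Ob A \<Longrightarrow> snd \<phi> a () = snd \<psi> a ()"
  shows "\<phi> = \<psi>"
proof (rule prod_eqI)
  show "snd \<phi> = snd \<psi>"
  proof (rule ext, rule ext)
    fix a u
    show "snd \<phi> a u = snd \<psi> a u"
      using assms presheaf_dist[OF assms(1)] presheaf_dist[OF assms(2)]
      by (cases "a \<in> Ob A") (auto simp: distributor_def PiE_iff extensional_def)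
  qed
qed (fact assms)

section \<open>The category of presheaves\<close>

lemma Ob_PSh [simp]: "Ob (PSh Q A) = presheaves Q A"
  by (simp add: PSh_def)

lemma Ty_PSh [simp]: "\<phi> \<in> presheaves Q A \<Longrightarrow> Ty (PSh Q A) \<phi> = fst \<phi>"
  by (simp add: PSh_def)

lemma Hm_PSh_Hom:
  assumes "qcategory Q A" "\<psi> \<in> presheaves Q A" "\<phi> \<in> presheaves Q A"
  shows "Hm (PSh Q A) \<psi> \<phi> \<in> Hom Q (fst \<phi>) (fst \<psi>)"
  using lifting_presheaf(1)[OF qcategory_one_object[OF presheaf_Obj[OF assms(3)]] assms(1)
      presheaf_Obj[OF assms(2)] presheaf_dist[OF assms(2)] presheaf_dist[OF assms(3)], of "()"] assms
  by (simp add: PSh_def)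

text \<open>The instance of \<open>lifting_presheaf\<close> for a one-object category
  \<open>D\<close>: homs of presheaves are residuals.\<close>

lemma le_Hm_PSh_iff:
  assumes "qcategory Q A" "\<psi> \<in> presheaves Q A" "\<phi> \<in> presheaves Q A"
    and "f \<in> Hom Q (fst \<phi>) (fst \<psi>)"
  shows "f \<preceq> Hm (PSh Q A) \<psi> \<phi> \<longleftrightarrow> (\<forall>a\<in>Ob A. snd \<psi> a () \<cdot> f \<preceq> snd \<phi> a ())"
  using lifting_presheaf(2)[OF qcategory_one_object[OF presheaf_Obj[OF assms(3)]] assms(1)
      presheaf_Obj[OF assms(2)] presheaf_dist[OF assms(2)] presheaf_dist[OF assms(3)], of "()"] assms
  by (simp add: PSh_def)

text \<open>The counit of the residuation, obtained by taking the hom itself for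
  \<open>f\<close>.\<close>

lemma PSh_eval:
  assumes "qcategory Q A" "\<psi> \<in> presheaves Q A" "\<phi> \<in> presheaves Q A" "a \<in> Ob A"
  shows "snd \<psi> a () \<cdot> Hm (PSh Q A) \<psi> \<phi> \<preceq> snd \<phi> a ()"
  using le_Hm_PSh_iff[OF assms(1-3)] Hm_PSh_Hom[OF assms(1-3)] Leq_refl assms(4) by blast

lemma qcategory_PSh:
  assumes A: "qcategory Q A"
  shows "qcategory Q (PSh Q A)"
  unfolding qcategory_def
proof (intro conjI ballI)
  show "Ty (PSh Q A) \<in> Ob (PSh Q A) \<rightarrow>\<^sub>E Obj Q"
    using presheaf_Obj by (auto simp: PSh_def PiE_iff)
  show "Hm (PSh Q A) \<in> (\<Pi>\<^sub>E a'\<in>Ob (PSh Q A). \<Pi>\<^sub>E a\<in>Ob (PSh Q A).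
      Hom Q (Ty (PSh Q A) a) (Ty (PSh Q A) a'))"
    using Hm_PSh_Hom[OF A] by (auto simp: PiE_iff) (auto simp: PSh_def)
next
  fix \<phi> assume "\<phi> \<in> Ob (PSh Q A)"
  then show "Idt Q (Ty (PSh Q A) \<phi>) \<preceq> Hm (PSh Q A) \<phi> \<phi>"
    using Cmp_Idt_right[OF presheaf_Hom[of \<phi>]] Leq_refl[OF presheaf_Hom[of \<phi>]]
      Idt_Hom[OF presheaf_Obj[of \<phi>]]
    by (simp add: le_Hm_PSh_iff[OF A])
next
  fix \<chi> \<psi> \<phi> assume *: "\<chi> \<in> Ob (PSh Q A)" "\<psi> \<in> Ob (PSh Q A)" "\<phi> \<in> Ob (PSh Q A)"
  let ?f = "Hm (PSh Q A) \<psi> \<phi>" and ?g = "Hm (PSh Q A) \<chi> \<psi>"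
  have f: "?f \<in> Hom Q (fst \<phi>) (fst \<psi>)" and g: "?g \<in> Hom Q (fst \<psi>) (fst \<chi>)"
    using * Hm_PSh_Hom[OF A] by auto
  \<comment> \<open>Evaluation is applied twice: \<open>?g\<close> carries \<chi> below \<psi>, and
    \<open>?f\<close> carries \<psi> below \<phi>.\<close>
  have "snd \<chi> a () \<cdot> (?g \<cdot> ?f) \<preceq> snd \<phi> a ()" if a: "a \<in> Ob A" for a
  proof -
    have "(snd \<chi> a () \<cdot> ?g) \<cdot> ?f \<preceq> snd \<phi> a ()"
      using * a f g PSh_eval[OF A, of \<chi> \<psi> a] PSh_eval[OF A, of \<psi> \<phi> a]
      by (auto intro!: Cmp_le_trans_left[of "snd \<chi> a () \<cdot> ?g" "snd \<psi> a ()"] Cmp_Hom presheaf_Hom)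
    then show ?thesis using Cmp_assoc[OF f g presheaf_Hom] * a by simp
  qed
  then show "?g \<cdot> ?f \<preceq> Hm (PSh Q A) \<chi> \<phi>"
    using * f g Cmp_Hom by (auto simp: le_Hm_PSh_iff[OF A])
qed

section \<open>The Yoneda embedding\<close>

lemma yoneda_simps [simp]:
  "a \<in> Ob A \<Longrightarrow> fst (yoneda A a) = Ty A a"
  "\<lbrakk>a \<in> Ob A; a' \<in> Ob A\<rbrakk> \<Longrightarrow> snd (yoneda A a) a' u = Hm A a' a"
  by (simp_all add: yoneda_def)

lemma yoneda_presheaf: "\<lbrakk>qcategory Q A; a \<in> Ob A\<rbrakk> \<Longrightarrow> yoneda A a \<in> presheaves Q A"
  by (auto simp: yoneda_def intro!: presheafI Ty_Obj Hm_Hom Hm_Cmp)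

text \<open>Both sides have the same arrows below them: the instance \<open>b = a\<close>, with the
  identity below \<open>Hm A a a\<close>, gives one direction, and the action of \<open>A\<close> on
  \<phi> gives the other.\<close>

lemma yoneda_lemma:
  assumes A: "qcategory Q A" and a: "a \<in> Ob A" and phi: "\<phi> \<in> presheaves Q A"
  shows "Hm (PSh Q A) (yoneda A a) \<phi> = snd \<phi> a ()"
proof (rule eq_if_same_lower)
  show "Hm (PSh Q A) (yoneda A a) \<phi> \<in> Hom Q (fst \<phi>) (Ty A a)"
    using Hm_PSh_Hom[OF A yoneda_presheaf[OF A a] phi] a by simp
  show H: "snd \<phi> a () \<in> Hom Q (fst \<phi>) (Ty A a)" using presheaf_Hom[OF phi a] .
  fix f assume f: "f \<in> Hom Q (fst \<phi>) (Ty A a)"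
  have "(\<forall>b\<in>Ob A. Hm A b a \<cdot> f \<preceq> snd \<phi> b ()) \<longleftrightarrow> f \<preceq> snd \<phi> a ()" (is "?l \<longleftrightarrow> ?r")
  proof
    assume ?l
    then show ?r
      using Leq_trans[OF le_Hm_Cmp_self[OF A a f] _ f Cmp_Hom[OF f Hm_Hom[OF A a a]] H] a by blast
  next
    assume ?r
    then show ?l
      using Cmp_le_trans_right[OF _ presheaf_act[OF phi _ a] f H Hm_Hom[OF A _ a] presheaf_Hom[OF phi]]
      by blast
  qed
  then show "f \<preceq> Hm (PSh Q A) (yoneda A a) \<phi> \<longleftrightarrow> f \<preceq> snd \<phi> a ()"
    using a f by (subst le_Hm_PSh_iff[OF A yoneda_presheaf[OF A a] phi]) auto
qed

section \<open>Functors and isomorphic objects\<close>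

lemma qfunctor_Ob: "\<lbrakk>qfunctor Q A B F; a \<in> Ob A\<rbrakk> \<Longrightarrow> F a \<in> Ob B"
  by (auto simp: qfunctor_def)

lemma qfunctor_Ty: "\<lbrakk>qfunctor Q A B F; a \<in> Ob A\<rbrakk> \<Longrightarrow> Ty B (F a) = Ty A a"
  by (auto simp: qfunctor_def)

lemma qfunctor_Hm: "\<lbrakk>qfunctor Q A B F; a' \<in> Ob A; a \<in> Ob A\<rbrakk> \<Longrightarrow> Hm A a' a \<preceq> Hm B (F a') (F a)"
  by (auto simp: qfunctor_def)

lemma qfunctor_Hm_Hom:
  "\<lbrakk>qfunctor Q A B F; qcategory Q B; a \<in> Ob A; b \<in> Ob B\<rbrakk> \<Longrightarrow> Hm B (F a) b \<in> Hom Q (Ty B b) (Ty A a)"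
  "\<lbrakk>qfunctor Q A B F; qcategory Q B; a \<in> Ob A; b \<in> Ob B\<rbrakk> \<Longrightarrow> Hm B b (F a) \<in> Hom Q (Ty A a) (Ty B b)"
  using Hm_Hom qfunctor_Ob qfunctor_Ty by metis+

lemma qfunctor_id: "qcategory Q A \<Longrightarrow> qfunctor Q A A (id_functor A)"
  using Hm_Hom Leq_refl by (fastforce simp: qfunctor_def)

lemma qfunctor_comp:
  assumes F: "qfunctor Q A B F" and G: "qfunctor Q B C G" and "qcategory Q A" "qcategory Q B" "qcategory Q C"
  shows "qfunctor Q A C (comp_functor A G F)"
  unfolding qfunctor_def
proof (intro conjI ballI)
  fix a' a assume *: "a' \<in> Ob A" "a \<in> Ob A"
  note T = qfunctor_Ob[OF F] qfunctor_Ob[OF G] qfunctor_Ty[OF F] qfunctor_Ty[OF G]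
  have "Hm A a' a \<preceq> Hm C (G (F a')) (G (F a))"
    using Leq_trans[OF qfunctor_Hm[OF F *] qfunctor_Hm[OF G]]
      Hm_Hom[OF assms(3) *] Hm_Hom[OF assms(4), of "F a'" "F a"] Hm_Hom[OF assms(5), of "G (F a')" "G (F a)"]
      * T by auto
  then show "Hm A a' a \<preceq> Hm C (comp_functor A G F a') (comp_functor A G F a)"
    using * by (simp add: compose_eq)
qed (use qfunctor_Ob[OF F] qfunctor_Ob[OF G] qfunctor_Ty[OF F] qfunctor_Ty[OF G] in \<open>auto simp: compose_def\<close>)

section \<open>Isomorphic objects\<close>

text \<open>Isomorphism is encoded as equality of the rows \<open>Hm B x\<close> and
  \<open>Hm B y\<close> because \<open>is_colim\<close> prescribes exactly such a row; uniqueness of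
  colimits is then immediate.\<close>

definition obj_iso :: "('a, 'o, 'm) qcat \<Rightarrow> 'a \<Rightarrow> 'a \<Rightarrow> bool" where
  "obj_iso B x y \<longleftrightarrow> x \<in> Ob B \<and> y \<in> Ob B \<and> Ty B x = Ty B y \<and> (\<forall>b\<in>Ob B. Hm B x b = Hm B y b)"

lemma obj_iso_Ob: "obj_iso B x y \<Longrightarrow> x \<in> Ob B" "obj_iso B x y \<Longrightarrow> y \<in> Ob B"
  by (simp_all add: obj_iso_def)

lemma obj_iso_Ty: "obj_iso B x y \<Longrightarrow> Ty B x = Ty B y"
  by (simp add: obj_iso_def)

lemma obj_iso_sym: "obj_iso B x y \<Longrightarrow> obj_iso B y x"
  by (simp add: obj_iso_def)

lemma obj_iso_trans: "\<lbrakk>obj_iso B x y; obj_iso B y z\<rbrakk> \<Longrightarrow> obj_iso B x z"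
  by (simp add: obj_iso_def)

text \<open>Composing with an identity arrow below \<open>Hm B x y\<close> compares the rows, or the
  columns, at \<open>x\<close> and \<open>y\<close>. The first criterion is the one that functors
  preserve; the second is what the order on functors yields.\<close>

lemma obj_iso_iff:
  assumes B: "qcategory Q B" and xy: "x \<in> Ob B" "y \<in> Ob B" "Ty B x = Ty B y"
  shows "obj_iso B x y \<longleftrightarrow> Idt Q (Ty B x) \<preceq> Hm B x y \<and> Idt Q (Ty B x) \<preceq> Hm B y x" (is ?thesis1)
    and "(\<forall>b\<in>Ob B. Hm B b x \<preceq> Hm B b y \<and> Hm B b y \<preceq> Hm B b x) \<longleftrightarrow> obj_iso B x y" (is ?thesis2)
proof -
  let ?p = "Idt Q (Ty B x) \<preceq> Hm B x y \<and> Idt Q (Ty B x) \<preceq> Hm B y x"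
  have id: "Idt Q (Ty B x) \<in> Hom Q (Ty B x) (Ty B x)" using Idt_Hom Ty_Obj[OF B xy(1)] .
  have cov: "Hm B v b \<preceq> Hm B u b" if "Idt Q (Ty B x) \<preceq> Hm B u v" "u \<in> {x, y}" "v \<in> {x, y}" "b \<in> Ob B" for u v b
    using Hm_Cmp_le[OF B _ _ that(4,1) Leq_refl, of "Ty B b" "Ty B x"] that xy id
      Hm_Hom[OF B, of v b] Cmp_Idt_left[OF Hm_Hom[OF B, of v b]]
    by auto
  have con: "Hm B b u \<preceq> Hm B b v" if "Idt Q (Ty B x) \<preceq> Hm B u v" "u \<in> {x, y}" "v \<in> {x, y}" "b \<in> Ob B" for u v b
    using Hm_Cmp_le[OF B that(4) _ _ Leq_refl that(1), of "Ty B x" "Ty B b"] that xy id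
      Hm_Hom[OF B, of b u] Cmp_Idt_right[OF Hm_Hom[OF B, of b u]]
    by auto
  have "?p \<Longrightarrow> obj_iso B x y"
    unfolding obj_iso_def using xy cov[of x y] cov[of y x] Hm_Hom[OF B, of x] Hm_Hom[OF B, of y]
    by (auto intro!: Leq_antisym)
  moreover have "obj_iso B x y \<Longrightarrow> ?p"
    using Hm_Idt[OF B xy(1)] Hm_Idt[OF B xy(2)] xy by (auto simp: obj_iso_def)
  ultimately show ?thesis1 by blast
  moreover have "(\<forall>b\<in>Ob B. Hm B b x \<preceq> Hm B b y \<and> Hm B b y \<preceq> Hm B b x) \<longleftrightarrow> ?p" (is "?l \<longleftrightarrow> ?p")
  proof
    assume ?p
    then show ?l using con[of x y] con[of y x] by auto
  next
    assume ?l
    then show ?p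
      using Leq_trans[OF Hm_Idt[OF B xy(1)], of "Hm B x y"] Leq_trans[OF Hm_Idt[OF B xy(2)], of "Hm B y x"]
        xy id Hm_Hom[OF B xy(1) xy(1)] Hm_Hom[OF B xy(2) xy(2)] Hm_Hom[OF B xy(1) xy(2)] Hm_Hom[OF B xy(2) xy(1)]
      by auto
  qed
  ultimately show ?thesis2 by blast
qed

text \<open>The order on functors compares the columns \<open>Hm B b (F a)\<close>, while
  \<open>obj_iso\<close> compares rows; \<open>obj_iso_iff\<close> translates between them.\<close>

lemma functor_iso_iff:
  assumes "qcategory Q B"
    and "\<And>a. a \<in> Ob A \<Longrightarrow> F a \<in> Ob B \<and> G a \<in> Ob B \<and> Ty B (F a) = Ty B (G a)"
  shows "functor_iso Q A B F G \<longleftrightarrow> (\<forall>a\<in>Ob A. obj_iso B (F a) (G a))"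
proof -
  have "obj_iso B (F a) (G a) \<longleftrightarrow>
      (\<forall>b\<in>Ob B. Hm B b (F a) \<preceq> Hm B b (G a) \<and> Hm B b (G a) \<preceq> Hm B b (F a))" if "a \<in> Ob A" for a
    using obj_iso_iff(2)[OF assms(1), of "F a" "G a"] assms(2)[OF that] by simp
  then show ?thesis
    by (auto simp: functor_iso_def functor_le_def dist_le_def graph_def)
qed

text \<open>Isomorphism means that the identity lies below the homs both ways, and a functor can
  only enlarge homs.\<close>

lemma qfunctor_obj_iso:
  assumes G: "qfunctor Q A B G" and A: "qcategory Q A" and B: "qcategory Q B" and xy: "obj_iso A x y"
  shows "obj_iso B (G x) (G y)"
proof -
  have *: "x \<in> Ob A" "y \<in> Ob A" "Ty A x = Ty A y" using xy by (auto simp: obj_iso_def)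
  have id: "Idt Q (Ty A x) \<in> Hom Q (Ty A x) (Ty A y)" "Idt Q (Ty A x) \<in> Hom Q (Ty A y) (Ty A x)"
    using Idt_Hom[OF Ty_Obj[OF A *(1)]] *(3) by simp_all
  have "Idt Q (Ty A x) \<preceq> Hm A x y" "Idt Q (Ty A x) \<preceq> Hm A y x"
    using obj_iso_iff(1)[OF A *] xy by auto
  then have "Idt Q (Ty A x) \<preceq> Hm B (G x) (G y)" "Idt Q (Ty A x) \<preceq> Hm B (G y) (G x)"
    using Leq_trans[OF _ qfunctor_Hm[OF G *(1,2)] id(2) Hm_Hom[OF A *(1,2)]]
      Leq_trans[OF _ qfunctor_Hm[OF G *(2,1)] id(1) Hm_Hom[OF A *(2,1)]]
      Hm_Hom[OF B qfunctor_Ob[OF G *(1)] qfunctor_Ob[OF G *(2)]]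
      Hm_Hom[OF B qfunctor_Ob[OF G *(2)] qfunctor_Ob[OF G *(1)]]
      qfunctor_Ty[OF G *(1)] qfunctor_Ty[OF G *(2)] by simp_all
  then show ?thesis
    using * qfunctor_Ob[OF G] qfunctor_Ty[OF G] by (subst obj_iso_iff(1)[OF B]) auto
qed

text \<open>The identity lies below a hom of presheaves exactly when the presheaves compare
  elementwise; antisymmetry turns the two comparisons into equality.\<close>

lemma PSh_obj_iso_eq:
  assumes A: "qcategory Q A" and "obj_iso (PSh Q A) \<phi> \<psi>"
  shows "\<phi> = \<psi>"
proof -
  have *: "\<phi> \<in> presheaves Q A" "\<psi> \<in> presheaves Q A" "fst \<phi> = fst \<psi>"
    using assms(2) by (auto simp: obj_iso_def)
  have "Idt Q (fst \<phi>) \<preceq> Hm (PSh Q A) \<phi> \<psi>" "Idt Q (fst \<phi>) \<preceq> Hm (PSh Q A) \<psi> \<phi>"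
    using obj_iso_iff(1)[OF qcategory_PSh[OF A], of \<phi> \<psi>] assms(2) * by auto
  then have "\<forall>a\<in>Ob A. snd \<phi> a () \<preceq> snd \<psi> a () \<and> snd \<psi> a () \<preceq> snd \<phi> a ()"
    using * Idt_Hom[OF presheaf_Obj[OF *(1)]] Cmp_Idt_right[OF presheaf_Hom[OF *(1)]]
      Cmp_Idt_right[OF presheaf_Hom[OF *(2)]]
    by (simp add: le_Hm_PSh_iff[OF A])
  then show ?thesis
    using * presheaf_Hom[OF *(1)] presheaf_Hom[OF *(2)] by (auto intro!: presheaf_eqI Leq_antisym)
qed

section \<open>Weighted colimits\<close>

text \<open>Replaces the lifting in the definition by its residuation. This requires that the
  cograph of \<open>F\<close> is a distributor.\<close>

lemma is_colim_iff:
  assumes A: "qcategory Q A" and B: "qcategory Q B" and F: "qfunctor Q A B F"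
    and phi: "\<phi> \<in> presheaves Q A"
  shows "is_colim Q A B \<phi> F c \<longleftrightarrow> c \<in> Ob B \<and> Ty B c = fst \<phi> \<and>
    (\<forall>b\<in>Ob B. \<forall>f\<in>Hom Q (Ty B b) (fst \<phi>).
      f \<preceq> Hm B c b \<longleftrightarrow> (\<forall>a\<in>Ob A. snd \<phi> a () \<cdot> f \<preceq> Hm B (F a) b))"
proof -
  note H = qfunctor_Hm_Hom[OF F B]
  have dist: "distributor Q B A (cograph A B F)"
    unfolding distributor_def
  proof (intro conjI ballI)
    show "cograph A B F \<in> (\<Pi>\<^sub>E b\<in>Ob A. \<Pi>\<^sub>E a\<in>Ob B. Hom Q (Ty B a) (Ty A b))"
      using H by (auto simp: cograph_def PiE_iff extensional_def)
    fix a a' b assume "a \<in> Ob A" "a' \<in> Ob A" "b \<in> Ob B"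
    then show "Hm A a a' \<cdot> cograph A B F a' b \<preceq> cograph A B F a b"
      using Hm_Cmp_le[OF B _ _ _ qfunctor_Hm[OF F] Leq_refl, of a a' b] Hm_Hom[OF A, of a a'] H
        qfunctor_Ob[OF F] qfunctor_Ty[OF F] by (auto simp: cograph_def)
  qed (use qfunctor_Ob[OF F] Hm_Cmp[OF B] in \<open>auto simp: cograph_def\<close>)
  let ?l = "lifting Q B (one_object Q (fst \<phi>)) A (snd \<phi>) (cograph A B F) ()"
  note L = lifting_presheaf[OF B A presheaf_Obj[OF phi] presheaf_dist[OF phi] dist]
  have "Hm B c b = ?l b \<longleftrightarrow> (\<forall>f\<in>Hom Q (Ty B b) (fst \<phi>). f \<preceq> Hm B c b \<longleftrightarrow>
      (\<forall>a\<in>Ob A. snd \<phi> a () \<cdot> f \<preceq> Hm B (F a) b))"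
    if c: "c \<in> Ob B" "Ty B c = fst \<phi>" and b: "b \<in> Ob B" for b
  proof -
    have below: "f \<preceq> ?l b \<longleftrightarrow> (\<forall>a\<in>Ob A. snd \<phi> a () \<cdot> f \<preceq> Hm B (F a) b)" if "f \<in> Hom Q (Ty B b) (fst \<phi>)" for f
      using L(2)[OF b that] b by (simp add: cograph_def)
    have cb: "Hm B c b \<in> Hom Q (Ty B b) (fst \<phi>)" using Hm_Hom[OF B c(1) b] c(2) by simp
    show ?thesis (is "?eq \<longleftrightarrow> ?up")
    proof
      assume ?eq
      then show ?up using below by (simp only:) blast
    next
      assume up: ?up
      show ?eq
        by (rule eq_if_same_lower[OF cb L(1)[OF b]]) (use below up in blast)
    qed
  qed
  then show ?thesis
    unfolding is_colim_def by (intro conj_cong ball_cong refl)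
qed

lemma is_colim_Ob: "is_colim Q A B \<phi> F c \<Longrightarrow> c \<in> Ob B"
  by (simp add: is_colim_def)

lemma is_colim_Ty: "is_colim Q A B \<phi> F c \<Longrightarrow> Ty B c = fst \<phi>"
  by (simp add: is_colim_def)

lemma is_colim_unique: "\<lbrakk>is_colim Q A B \<phi> F c; is_colim Q A B \<phi> F c'\<rbrakk> \<Longrightarrow> obj_iso B c c'"
  by (simp add: is_colim_def obj_iso_def)

lemma is_colim_obj_iso: "\<lbrakk>is_colim Q A B \<phi> F c; obj_iso B c c'\<rbrakk> \<Longrightarrow> is_colim Q A B \<phi> F c'"
  by (auto simp: is_colim_def obj_iso_def)

text \<open>The universal property at \<open>b = c\<close>, applied to the identity, which lies
  below \<open>Hm B c c\<close>.\<close>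

lemma is_colim_cocone:
  assumes A: "qcategory Q A" and B: "qcategory Q B" and F: "qfunctor Q A B F"
    and phi: "\<phi> \<in> presheaves Q A" and c: "is_colim Q A B \<phi> F c" and a: "a \<in> Ob A"
  shows "snd \<phi> a () \<preceq> Hm B (F a) c"
proof -
  have *: "c \<in> Ob B" "Ty B c = fst \<phi>" using c by (auto simp: is_colim_def)
  have id: "Idt Q (fst \<phi>) \<in> Hom Q (fst \<phi>) (fst \<phi>)" using Idt_Hom[OF presheaf_Obj[OF phi]] .
  have "Idt Q (fst \<phi>) \<preceq> Hm B c c" using Hm_Idt[OF B *(1)] * by simp
  then have "snd \<phi> a () \<cdot> Idt Q (fst \<phi>) \<preceq> Hm B (F a) c"
    using c id * a unfolding is_colim_iff[OF A B F phi] by auto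
  then show ?thesis using Cmp_Idt_right[OF presheaf_Hom[OF phi a]] by simp
qed

section \<open>Colimits in presheaf categories\<close>

text \<open>Testing the pointwise join against \<psi> means testing each of its terms; after
  reassociation the quantifiers over \<open>Ob A\<close> and \<open>Ob B\<close> are exchanged, and
  the inner one becomes a hom out of \<open>G a\<close>.\<close>

lemma PSh_colim:
  assumes A: "qcategory Q A" and B: "qcategory Q B" and G: "qfunctor Q A (PSh Q B) G"
    and phi: "\<phi> \<in> presheaves Q A"
  shows "is_colim Q A (PSh Q B) \<phi> G (fst \<phi>,
    \<lambda>b\<in>Ob B. \<lambda>_. Join Q (fst \<phi>) (Ty B b) ((\<lambda>a. snd (G a) b () \<cdot> snd \<phi> a ()) ` Ob A))"
    (is "is_colim _ _ _ _ _ ?c")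
proof -
  define p where "p b = Join Q (fst \<phi>) (Ty B b) ((\<lambda>a. snd (G a) b () \<cdot> snd \<phi> a ()) ` Ob A)" for b
  have X: "fst \<phi> \<in> Obj Q" using presheaf_Obj[OF phi] .
  have Ga: "G a \<in> presheaves Q B" "fst (G a) = Ty A a" if "a \<in> Ob A" for a
    using qfunctor_Ob[OF G that] qfunctor_Ty[OF G that] by auto
  have G1: "snd (G a) b () \<in> Hom Q (Ty A a) (Ty B b)" if "a \<in> Ob A" "b \<in> Ob B" for a b
    using presheaf_Hom[OF Ga(1)] Ga(2) that by metis
  have sub: "(\<lambda>a. snd (G a) b () \<cdot> snd \<phi> a ()) ` Ob A \<subseteq> Hom Q (fst \<phi>) (Ty B b)" if "b \<in> Ob B" for b
    using Cmp_Hom[OF presheaf_Hom[OF phi] G1] that by auto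
  have pH: "p b \<in> Hom Q (fst \<phi>) (Ty B b)" if "b \<in> Ob B" for b
    unfolding p_def using Join_Hom[OF X Ty_Obj[OF B that] sub[OF that]] .
  have "Hm B b b' \<cdot> p b' \<preceq> p b" if b: "b \<in> Ob B" "b' \<in> Ob B" for b b'
    unfolding p_def
  proof (subst Cmp_Join_le_iff[OF X Ty_Obj[OF B b(2)] Ty_Obj[OF B b(1)] sub[OF b(2)] Hm_Hom[OF B b]],
      fold p_def, rule pH[OF b(1)], clarify)
    fix a assume a: "a \<in> Ob A"
    have "Hm B b b' \<cdot> (snd (G a) b' () \<cdot> snd \<phi> a ()) = (Hm B b b' \<cdot> snd (G a) b' ()) \<cdot> snd \<phi> a ()"
      using Cmp_assoc[OF presheaf_Hom[OF phi a] G1[OF a b(2)] Hm_Hom[OF B b]] .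
    also have "\<dots> \<preceq> p b"
    proof (rule Cmp_le_trans_left[OF presheaf_act[OF Ga(1)[OF a] b]])
      show "snd (G a) b () \<cdot> snd \<phi> a () \<preceq> p b"
        unfolding p_def using Join_upper[OF sub[OF b(1)]] a by blast
    qed (rule Cmp_Hom[OF G1[OF a b(2)] Hm_Hom[OF B b]] G1[OF a b(1)] presheaf_Hom[OF phi a] pH[OF b(1)])+
    finally show "Hm B b b' \<cdot> (snd (G a) b' () \<cdot> snd \<phi> a ()) \<preceq> p b" .
  qed
  then have c: "?c \<in> presheaves Q B"
    using presheafI[OF X, of B p] pH unfolding p_def by blast
  have "f \<preceq> Hm (PSh Q B) ?c \<psi> \<longleftrightarrow> (\<forall>a\<in>Ob A. snd \<phi> a () \<cdot> f \<preceq> Hm (PSh Q B) (G a) \<psi>)"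
    if psi: "\<psi> \<in> presheaves Q B" and f: "f \<in> Hom Q (fst \<psi>) (fst \<phi>)" for \<psi> f
  proof -
    have "f \<preceq> Hm (PSh Q B) ?c \<psi> \<longleftrightarrow> (\<forall>b\<in>Ob B. p b \<cdot> f \<preceq> snd \<psi> b ())"
      using le_Hm_PSh_iff[OF B c psi, of f] f by (auto simp: p_def)
    also have "\<dots> \<longleftrightarrow> (\<forall>b\<in>Ob B. \<forall>a\<in>Ob A. (snd (G a) b () \<cdot> snd \<phi> a ()) \<cdot> f \<preceq> snd \<psi> b ())"
      unfolding p_def
      using Join_Cmp_le_iff[OF presheaf_Obj[OF psi] X Ty_Obj[OF B] sub f presheaf_Hom[OF psi]] by simp
    also have "\<dots> \<longleftrightarrow> (\<forall>a\<in>Ob A. \<forall>b\<in>Ob B. snd (G a) b () \<cdot> (snd \<phi> a () \<cdot> f) \<preceq> snd \<psi> b ())"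
      using Cmp_assoc[OF f presheaf_Hom[OF phi] G1] by auto
    also have "\<dots> \<longleftrightarrow> (\<forall>a\<in>Ob A. snd \<phi> a () \<cdot> f \<preceq> Hm (PSh Q B) (G a) \<psi>)"
      using le_Hm_PSh_iff[OF B Ga(1) psi] Cmp_Hom[OF f presheaf_Hom[OF phi]] Ga(2) by simp
    finally show ?thesis .
  qed
  then show ?thesis
    using c by (subst is_colim_iff[OF A qcategory_PSh[OF B] G phi]) auto
qed

text \<open>\<open>colim\<close> is a choice by \<open>SOME\<close>, but a colimit exists here and
  skeletality makes it the only one.\<close>

lemma is_colim_PSh_iff:
  assumes A: "qcategory Q A" and B: "qcategory Q B" and G: "qfunctor Q A (PSh Q B) G"
    and phi: "\<phi> \<in> presheaves Q A"
  shows "is_colim Q A (PSh Q B) \<phi> G c \<longleftrightarrow> c = colim Q A (PSh Q B) \<phi> G"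
proof -
  have "is_colim Q A (PSh Q B) \<phi> G (colim Q A (PSh Q B) \<phi> G)"
    unfolding colim_def using PSh_colim[OF assms] by (rule someI)
  then show ?thesis using PSh_obj_iso_eq[OF B is_colim_unique] by metis
qed

section \<open>Direct images of presheaves and change of weight\<close>

text \<open>In the third claim, distributivity replaces the join that defines the direct image by a
  condition on each \<open>a\<close>; \<open>is_colim_PSh_map\<close> uses it in this form.\<close>

lemma PSh_map_presheaf:
  assumes A: "qcategory Q A" and B: "qcategory Q B" and F: "qfunctor Q A B F"
    and phi: "\<phi> \<in> presheaves Q A"
  shows "PSh_map Q A B F \<phi> \<in> presheaves Q B" (is ?thesis1)
    and "fst (PSh_map Q A B F \<phi>) = fst \<phi>" (is ?thesis2)
    and "\<lbrakk>b \<in> Ob B; f \<in> Hom Q Y (fst \<phi>); h \<in> Hom Q Y (Ty B b)\<rbrakk> \<Longrightarrow>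
      snd (PSh_map Q A B F \<phi>) b () \<cdot> f \<preceq> h \<longleftrightarrow> (\<forall>a\<in>Ob A. (Hm B b (F a) \<cdot> snd \<phi> a ()) \<cdot> f \<preceq> h)"
      (is "\<lbrakk>_; _; _\<rbrakk> \<Longrightarrow> ?thesis3")
proof -
  define p where "p b = Join Q (fst \<phi>) (Ty B b) ((\<lambda>a. Hm B b (F a) \<cdot> snd \<phi> a ()) ` Ob A)" for b
  have eq: "PSh_map Q A B F \<phi> = (fst \<phi>, \<lambda>b\<in>Ob B. \<lambda>_. p b)"
    using phi by (auto simp: PSh_map_def dist_comp_def graph_def p_def fun_eq_iff intro!: restrict_ext arg_cong2[where f="Join Q _"])
  have X: "fst \<phi> \<in> Obj Q" using presheaf_Obj[OF phi] .
  note H = qfunctor_Hm_Hom(2)[OF F B] presheaf_Hom[OF phi]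
  have sub: "(\<lambda>a. Hm B b (F a) \<cdot> snd \<phi> a ()) ` Ob A \<subseteq> Hom Q (fst \<phi>) (Ty B b)" if "b \<in> Ob B" for b
    using Cmp_Hom[OF H(2) H(1)] that by auto
  have pH: "p b \<in> Hom Q (fst \<phi>) (Ty B b)" if "b \<in> Ob B" for b
    unfolding p_def using Join_Hom[OF X Ty_Obj[OF B that] sub[OF that]] .
  have "Hm B b b' \<cdot> p b' \<preceq> p b" if b: "b \<in> Ob B" "b' \<in> Ob B" for b b'
    unfolding p_def
  proof (subst Cmp_Join_le_iff[OF X Ty_Obj[OF B b(2)] Ty_Obj[OF B b(1)] sub[OF b(2)] Hm_Hom[OF B b]],
      fold p_def, rule pH[OF b(1)], clarify)
    fix a assume a: "a \<in> Ob A"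
    have "Hm B b b' \<cdot> (Hm B b' (F a) \<cdot> snd \<phi> a ()) = (Hm B b b' \<cdot> Hm B b' (F a)) \<cdot> snd \<phi> a ()"
      using Cmp_assoc[OF H(2)[OF a] H(1)[OF a b(2)] Hm_Hom[OF B b]] .
    also have "\<dots> \<preceq> p b"
    proof (rule Cmp_le_trans_left[OF Hm_Cmp[OF B b qfunctor_Ob[OF F a]]])
      show "Hm B b (F a) \<cdot> snd \<phi> a () \<preceq> p b"
        unfolding p_def using Join_upper[OF sub[OF b(1)]] a by blast
    qed (rule Cmp_Hom[OF H(1)[OF a b(2)] Hm_Hom[OF B b]] H(1)[OF a b(1)] H(2)[OF a] pH[OF b(1)])+
    finally show "Hm B b b' \<cdot> (Hm B b' (F a) \<cdot> snd \<phi> a ()) \<preceq> p b" .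
  qed
  then show ?thesis1 unfolding eq using presheafI[OF X, of B p] pH by blast
  show ?thesis2 by (simp add: eq)
  show ?thesis3 if "b \<in> Ob B" "f \<in> Hom Q Y (fst \<phi>)" "h \<in> Hom Q Y (Ty B b)"
    using Join_Cmp_le_iff[OF Hom_Obj(1)[OF that(2)] X Ty_Obj[OF B that(1)] sub[OF that(1)] that(2,3)] that(1)
    by (simp add: eq p_def)
qed

text \<open>Testing all pairs \<open>b\<close>, \<open>a\<close> amounts to testing
  \<open>b = H a\<close>. In one direction the identity lies below \<open>Hm B (H a) (H a)\<close>;
  in the other, \<open>F\<close> carries \<open>Hm B b (H a)\<close> below the corresponding hom of
  \<open>C\<close>.\<close>

lemma is_colim_PSh_map:
  assumes A: "qcategory Q A" and B: "qcategory Q B" and C: "qcategory Q C"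
    and H: "qfunctor Q A B H" and F: "qfunctor Q B C F" and phi: "\<phi> \<in> presheaves Q A"
  shows "is_colim Q B C (PSh_map Q A B H \<phi>) F c \<longleftrightarrow> is_colim Q A C \<phi> (comp_functor A F H) c"
proof -
  note P = PSh_map_presheaf[OF A B H phi]
  have "(\<forall>b\<in>Ob B. snd (PSh_map Q A B H \<phi>) b () \<cdot> f \<preceq> Hm C (F b) d)
      \<longleftrightarrow> (\<forall>a\<in>Ob A. snd \<phi> a () \<cdot> f \<preceq> Hm C (F (H a)) d)" (is "?l \<longleftrightarrow> ?r")
    if d: "d \<in> Ob C" and f: "f \<in> Hom Q (Ty C d) (fst \<phi>)" for d f
  proof -
    note FH = qfunctor_Hm_Hom(1)[OF F C _ d]
    have g: "snd \<phi> a () \<cdot> f \<in> Hom Q (Ty C d) (Ty A a)" if "a \<in> Ob A" for a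
      using Cmp_Hom[OF f presheaf_Hom[OF phi that]] .
    have "?l \<longleftrightarrow> (\<forall>b\<in>Ob B. \<forall>a\<in>Ob A. (Hm B b (H a) \<cdot> snd \<phi> a ()) \<cdot> f \<preceq> Hm C (F b) d)"
      using P(3)[OF _ f FH] by simp
    also have "\<dots> \<longleftrightarrow> (\<forall>b\<in>Ob B. \<forall>a\<in>Ob A. Hm B b (H a) \<cdot> (snd \<phi> a () \<cdot> f) \<preceq> Hm C (F b) d)"
      using Cmp_assoc[OF f presheaf_Hom[OF phi] qfunctor_Hm_Hom(2)[OF H B]] by simp
    also have "\<dots> \<longleftrightarrow> ?r"
    proof
      assume l: "\<forall>b\<in>Ob B. \<forall>a\<in>Ob A. Hm B b (H a) \<cdot> (snd \<phi> a () \<cdot> f) \<preceq> Hm C (F b) d"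
      show ?r
      proof
        fix a assume a: "a \<in> Ob A"
        have Ha: "H a \<in> Ob B" "Ty B (H a) = Ty A a" using qfunctor_Ob[OF H a] qfunctor_Ty[OF H a] .
        have "snd \<phi> a () \<cdot> f \<preceq> Hm B (H a) (H a) \<cdot> (snd \<phi> a () \<cdot> f)"
          using le_Hm_Cmp_self[OF B Ha(1)] g[OF a] Ha by simp
        moreover have "Hm B (H a) (H a) \<cdot> (snd \<phi> a () \<cdot> f) \<preceq> Hm C (F (H a)) d" using l a Ha by blast
        ultimately show "snd \<phi> a () \<cdot> f \<preceq> Hm C (F (H a)) d"
          using Leq_trans[OF _ _ g[OF a] _ FH[OF Ha(1), unfolded Ha(2)]] Cmp_Hom[OF g[OF a]]
            Hm_Hom[OF B Ha(1) Ha(1), unfolded Ha(2)] by blast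
      qed
    next
      assume r: ?r
      show "\<forall>b\<in>Ob B. \<forall>a\<in>Ob A. Hm B b (H a) \<cdot> (snd \<phi> a () \<cdot> f) \<preceq> Hm C (F b) d"
      proof (intro ballI)
        fix b a assume b: "b \<in> Ob B" and a: "a \<in> Ob A"
        have Ha: "H a \<in> Ob B" "Ty B (H a) = Ty A a" using qfunctor_Ob[OF H a] qfunctor_Ty[OF H a] .
        show "Hm B b (H a) \<cdot> (snd \<phi> a () \<cdot> f) \<preceq> Hm C (F b) d"
        proof (rule Hm_Cmp_le[OF C qfunctor_Ob[OF F b] qfunctor_Ob[OF F Ha(1)] d qfunctor_Hm[OF F b Ha(1)]])
          show "snd \<phi> a () \<cdot> f \<preceq> Hm C (F (H a)) d" using r a by blast
        qed (use g[OF a] Hm_Hom[OF B b Ha(1)] Ha b qfunctor_Ty[OF F] in simp_all)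
      qed
    qed
    finally show ?thesis .
  qed
  then show ?thesis
    using is_colim_iff[OF B C F P(1)] is_colim_iff[OF A C qfunctor_comp[OF H F A B C] phi] P(2)
    by (simp add: compose_eq cong: ball_cong_simp conj_cong)
qed

section \<open>Colimits of the identity functor\<close>

lemma comp_functor_id_left: "qfunctor Q A B F \<Longrightarrow> comp_functor A (id_functor B) F = F"
  by (auto simp: qfunctor_def Id_compose PiE_def)

lemma comp_functor_id_right: "qfunctor Q A B F \<Longrightarrow> comp_functor A F (id_functor A) = F"
  by (auto simp: qfunctor_def compose_Id PiE_def)

text \<open>Change of weight along \<open>F\<close> itself turns every weighted colimit in
  \<open>B\<close> into one of the identity functor.\<close>

lemma is_colim_PSh_map_id:
  assumes "qcategory Q A" "qcategory Q B" "qfunctor Q A B F" "\<phi> \<in> presheaves Q A"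
  shows "is_colim Q B B (PSh_map Q A B F \<phi>) (id_functor B) c \<longleftrightarrow> is_colim Q A B \<phi> F c"
  using is_colim_PSh_map[OF assms(1,2,2,3) qfunctor_id[OF assms(2)] assms(4)]
    comp_functor_id_left[OF assms(3)] by simp

text \<open>The universal property of \<open>c\<close> at \<open>b\<close> is the residuation for
  homs into \<open>yoneda B b\<close>. Thus \<open>c\<close> is the value at \<phi> of a partial
  left adjoint to the Yoneda embedding.\<close>

lemma is_colim_id_iff:
  assumes B: "qcategory Q B" and phi: "\<phi> \<in> presheaves Q B"
  shows "is_colim Q B B \<phi> (id_functor B) c \<longleftrightarrow>
    c \<in> Ob B \<and> Ty B c = fst \<phi> \<and> (\<forall>b\<in>Ob B. Hm B c b = Hm (PSh Q B) \<phi> (yoneda B b))"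
proof -
  have "(\<forall>f\<in>Hom Q (Ty B b) (fst \<phi>). f \<preceq> Hm B c b \<longleftrightarrow>
        (\<forall>a\<in>Ob B. snd \<phi> a () \<cdot> f \<preceq> Hm B (id_functor B a) b)) \<longleftrightarrow>
      Hm B c b = Hm (PSh Q B) \<phi> (yoneda B b)" (is "?up \<longleftrightarrow> ?eq")
    if c: "c \<in> Ob B" "Ty B c = fst \<phi>" and b: "b \<in> Ob B" for b
  proof -
    have Y: "yoneda B b \<in> presheaves Q B" using yoneda_presheaf[OF B b] .
    have below: "f \<preceq> Hm (PSh Q B) \<phi> (yoneda B b) \<longleftrightarrow>
        (\<forall>a\<in>Ob B. snd \<phi> a () \<cdot> f \<preceq> Hm B (id_functor B a) b)" if "f \<in> Hom Q (Ty B b) (fst \<phi>)" for f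
      using le_Hm_PSh_iff[OF B phi Y, of f] that b by simp
    have H: "Hm B c b \<in> Hom Q (Ty B b) (fst \<phi>)"
      "Hm (PSh Q B) \<phi> (yoneda B b) \<in> Hom Q (Ty B b) (fst \<phi>)"
      using Hm_Hom[OF B c(1) b] c(2) Hm_PSh_Hom[OF B phi Y] b by simp_all
    show ?thesis
    proof
      assume up: ?up
      show ?eq
        by (rule eq_if_same_lower[OF H]) (use below up in blast)
    next
      assume ?eq
      then show ?up using below by (simp only:) blast
    qed
  qed
  then show ?thesis
    unfolding is_colim_iff[OF B B qfunctor_id[OF B] phi] by (intro conj_cong ball_cong refl)
qed

lemma is_colim_yoneda:
  assumes B: "qcategory Q B" and b: "b \<in> Ob B"
  shows "is_colim Q B B (yoneda B b) (id_functor B) b"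
  using yoneda_lemma[OF B b yoneda_presheaf[OF B]] b
  by (simp add: is_colim_id_iff[OF B yoneda_presheaf[OF B b]])

end

section \<open>Full sub-KZ-doctrines\<close>

text \<open>The factorisations \<mu> and \<eta> are parameters, so that the results on algebras hold
  for every choice of them.\<close>

locale sub_KZ = quantaloid Q
  for Q :: "('o, 'm) quantaloid_data" (structure) +
  fixes small :: "'u set \<Rightarrow> bool"
    and T :: "('u, 'o, 'm) qcat \<Rightarrow> ('u, 'o, 'm) qcat"
    and T\<^sub>1 :: "('u, 'o, 'm) qcat \<Rightarrow> ('u, 'o, 'm) qcat \<Rightarrow> ('u \<Rightarrow> 'u) \<Rightarrow> 'u \<Rightarrow> 'u"
    and \<epsilon> :: "('u, 'o, 'm) qcat \<Rightarrow> 'u \<Rightarrow> ('u, 'o, 'm) presheaf"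
    and \<mu> \<eta> :: "('u, 'o, 'm) qcat \<Rightarrow> 'u \<Rightarrow> 'u"
  assumes doctrine: "full_sub_KZ_doctrine small Q T T\<^sub>1 \<epsilon>"
    and mult: "mult_factorisation small Q T \<epsilon> \<mu>"
    and unit: "unit_factorisation small Q T \<epsilon> \<eta>"
begin

lemma QCat_qcategory: "A \<in> QCat small Q \<Longrightarrow> qcategory Q A"
  by (simp add: QCat_def)

lemma T_QCat: "A \<in> QCat small Q \<Longrightarrow> T A \<in> QCat small Q"
  using doctrine by (simp add: full_sub_KZ_doctrine_def two_functor_def)

lemma T_qcategory: "A \<in> QCat small Q \<Longrightarrow> qcategory Q (T A)"
  by (simp add: T_QCat QCat_qcategory)

lemma T1_qfunctor:
  "\<lbrakk>A \<in> QCat small Q; B \<in> QCat small Q; qfunctor Q A B F\<rbrakk> \<Longrightarrow> qfunctor Q (T A) (T B) (T\<^sub>1 A B F)"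
  using doctrine by (simp add: full_sub_KZ_doctrine_def two_functor_def)

lemma eps_qfunctor: "A \<in> QCat small Q \<Longrightarrow> qfunctor Q (T A) (PSh Q A) (\<epsilon> A)"
  using doctrine by (simp add: full_sub_KZ_doctrine_def natural_to_PSh_def)

lemma mu_qfunctor: "A \<in> QCat small Q \<Longrightarrow> qfunctor Q (T (T A)) (T A) (\<mu> A)"
  using mult by (simp add: mult_factorisation_def)

lemma eta_qfunctor: "A \<in> QCat small Q \<Longrightarrow> qfunctor Q A (T A) (\<eta> A)"
  using unit by (simp add: unit_factorisation_def)

lemma eps_presheaf: "\<lbrakk>A \<in> QCat small Q; t \<in> Ob (T A)\<rbrakk> \<Longrightarrow> \<epsilon> A t \<in> presheaves Q A"
  using qfunctor_Ob[OF eps_qfunctor] by simp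

lemma eps_fst: "\<lbrakk>A \<in> QCat small Q; t \<in> Ob (T A)\<rbrakk> \<Longrightarrow> fst (\<epsilon> A t) = Ty (T A) t"
  using qfunctor_Ty[OF eps_qfunctor] eps_presheaf by simp

lemma eps_Hm: "\<lbrakk>A \<in> QCat small Q; s \<in> Ob (T A); t \<in> Ob (T A)\<rbrakk>
    \<Longrightarrow> Hm (PSh Q A) (\<epsilon> A s) (\<epsilon> A t) = Hm (T A) s t"
  using doctrine by (simp add: full_sub_KZ_doctrine_def fully_faithful_def)

section \<open>The doctrine in terms of presheaves\<close>

lemma functor_iso_PSh_eq:
  assumes A: "qcategory Q A" and iso: "functor_iso Q D (PSh Q A) F G" and d: "d \<in> Ob D"
    and "\<And>d. d \<in> Ob D \<Longrightarrow> F d \<in> presheaves Q A \<and> G d \<in> presheaves Q A \<and> fst (F d) = fst (G d)"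
  shows "F d = G d"
  using iso functor_iso_iff[OF qcategory_PSh[OF A], of D F G] assms(4) d
  by (auto intro: PSh_obj_iso_eq[OF A])

lemma eps_T1:
  assumes A: "A \<in> QCat small Q" and B: "B \<in> QCat small Q" and F: "qfunctor Q A B F"
    and t: "t \<in> Ob (T A)"
  shows "\<epsilon> B (T\<^sub>1 A B F t) = PSh_map Q A B F (\<epsilon> A t)"
proof -
  note T1 = T1_qfunctor[OF A B F]
  note P = PSh_map_presheaf(1,2)[OF QCat_qcategory[OF A] QCat_qcategory[OF B] F eps_presheaf[OF A]]
  have "functor_iso Q (T A) (PSh Q B) (comp_functor (T A) (PSh_map Q A B F) (\<epsilon> A))
      (comp_functor (T A) (\<epsilon> B) (T\<^sub>1 A B F))"
    using doctrine A B F by (simp add: full_sub_KZ_doctrine_def natural_to_PSh_def)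
  from functor_iso_PSh_eq[OF QCat_qcategory[OF B] this t] show ?thesis
    using P eps_presheaf[OF B qfunctor_Ob[OF T1]] eps_fst[OF A] eps_fst[OF B qfunctor_Ob[OF T1]]
      qfunctor_Ty[OF T1] t
    by (simp add: compose_eq)
qed

lemma eps_eta:
  assumes A: "A \<in> QCat small Q" and a: "a \<in> Ob A"
  shows "\<epsilon> A (\<eta> A a) = yoneda A a"
proof -
  note E = eta_qfunctor[OF A]
  have "functor_iso Q A (PSh Q A) (yoneda A) (comp_functor A (\<epsilon> A) (\<eta> A))"
    using unit A by (simp add: unit_factorisation_def)
  from functor_iso_PSh_eq[OF QCat_qcategory[OF A] this a] show ?thesis
    using yoneda_presheaf[OF QCat_qcategory[OF A]] eps_presheaf[OF A qfunctor_Ob[OF E]]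
      eps_fst[OF A qfunctor_Ob[OF E]] qfunctor_Ty[OF E] a
    by (simp add: compose_eq)
qed

text \<open>By the Yoneda lemma the value at \<open>a\<close> is the hom from
  \<open>yoneda A a\<close>, which is \<open>\<epsilon> A (\<eta> A a)\<close>; full faithfulness
  moves this hom into \<open>T A\<close>.\<close>

lemma eps_value:
  assumes A: "A \<in> QCat small Q" and a: "a \<in> Ob A" and t: "t \<in> Ob (T A)"
  shows "snd (\<epsilon> A t) a () = Hm (T A) (\<eta> A a) t"
  using yoneda_lemma[OF QCat_qcategory[OF A] a eps_presheaf[OF A t]]
    eps_Hm[OF A qfunctor_Ob[OF eta_qfunctor[OF A] a] t] eps_eta[OF A a] by simp

text \<open>The multiplication of presheaves takes the colimit of the identity weighted by the
  direct image of \<open>\<epsilon> (T A) s\<close> along \<open>\<epsilon> A\<close>; change of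
  weight moves \<open>\<epsilon> A\<close> into the diagram.\<close>

lemma eps_mu:
  assumes A: "A \<in> QCat small Q" and s: "s \<in> Ob (T (T A))"
  shows "is_colim Q (T A) (PSh Q A) (\<epsilon> (T A) s) (\<epsilon> A) (\<epsilon> A (\<mu> A s))"
proof -
  note M = mu_qfunctor[OF A] and E = eps_qfunctor[OF A]
  note cA = QCat_qcategory[OF A] and cTA = T_qcategory[OF A]
  note es = eps_presheaf[OF T_QCat[OF A]]
  let ?W = "\<lambda>s. PSh_map Q (T A) (PSh Q A) (\<epsilon> A) (\<epsilon> (T A) s)"
  let ?c = "\<lambda>s. comp_functor (T (T A)) (PSh_mult Q A) (eps_square Q T \<epsilon> A) s"
  note P = PSh_map_presheaf(1,2)[OF cTA qcategory_PSh[OF cA] E es]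
  have col: "is_colim Q (T A) (PSh Q A) (\<epsilon> (T A) s) (\<epsilon> A) (?c s)" if s: "s \<in> Ob (T (T A))" for s
  proof -
    have "?c s = colim Q (PSh Q A) (PSh Q A) (?W s) (id_functor (PSh Q A))"
      using P s by (simp add: compose_eq eps_square_def PSh_mult_def)
    then have "is_colim Q (PSh Q A) (PSh Q A) (?W s) (id_functor (PSh Q A)) (?c s)"
      using is_colim_PSh_iff[OF qcategory_PSh[OF cA] cA qfunctor_id[OF qcategory_PSh[OF cA]] P(1)[OF s]]
      by simp
    then show ?thesis
      using is_colim_PSh_map_id[OF cTA qcategory_PSh[OF cA] E es[OF s]] by simp
  qed
  have "functor_iso Q (T (T A)) (PSh Q A) ?c (comp_functor (T (T A)) (\<epsilon> A) (\<mu> A))"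
    using mult A by (simp add: mult_factorisation_def)
  from functor_iso_PSh_eq[OF cA this s]
  have "?c s = \<epsilon> A (\<mu> A s)"
    using is_colim_Ob[OF col] is_colim_Ty[OF col] eps_presheaf[OF A qfunctor_Ob[OF M]]
      eps_fst[OF A qfunctor_Ob[OF M]] eps_fst[OF T_QCat[OF A]] qfunctor_Ty[OF M] s
    by (simp add: compose_eq)
  with col[OF s] show ?thesis by simp
qed

text \<open>Since \<open>\<epsilon> B\<close> is fully faithful, \<open>G\<close> lifts to a functor \<open>H : A \<rightarrow> T B\<close>, and the colimit is
  the image under \<open>\<epsilon> B\<close> of \<open>\<mu> B (T\<^sub>1 H t)\<close>, where \<open>\<phi> = \<epsilon> A t\<close>.\<close>

lemma colim_in_doctrine_class:
  assumes C: "(A, \<phi>) \<in> doctrine_class small Q T \<epsilon>" and B: "B \<in> QCat small Q"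
    and G: "qfunctor Q A (PSh Q B) G" and GC: "\<And>a. a \<in> Ob A \<Longrightarrow> (B, G a) \<in> doctrine_class small Q T \<epsilon>"
  shows "(B, colim Q A (PSh Q B) \<phi> G) \<in> doctrine_class small Q T \<epsilon>"
proof -
  from C obtain t where A: "A \<in> QCat small Q" and t: "t \<in> Ob (T A)" and phi: "\<phi> = \<epsilon> A t"
    by (auto simp: doctrine_class_def)
  have "\<exists>u. u \<in> Ob (T B) \<and> \<epsilon> B u = G a" if "a \<in> Ob A" for a
    using GC[OF that] by (auto simp: doctrine_class_def)
  then obtain h where h: "\<And>a. a \<in> Ob A \<Longrightarrow> h a \<in> Ob (T B) \<and> \<epsilon> B (h a) = G a" by metis
  define H where "H = (\<lambda>a\<in>Ob A. h a)"
  have H: "H a \<in> Ob (T B)" "\<epsilon> B (H a) = G a" if "a \<in> Ob A" for a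
    using h that by (auto simp: H_def)
  have Hf: "qfunctor Q A (T B) H"
    unfolding qfunctor_def
  proof (intro conjI ballI)
    show "H \<in> Ob A \<rightarrow>\<^sub>E Ob (T B)" using h by (auto simp: H_def)
    show "Ty (T B) (H a) = Ty A a" if "a \<in> Ob A" for a
      using qfunctor_Ty[OF G that] eps_fst[OF B] eps_presheaf[OF B] H[OF that] by fastforce
    show "Hm A a' a \<preceq> Hm (T B) (H a') (H a)" if "a' \<in> Ob A" "a \<in> Ob A" for a' a
      using qfunctor_Hm[OF G that] eps_Hm[OF B, of "H a'" "H a"] H that by simp
  qed
  have comp: "comp_functor A (\<epsilon> B) H = G"
    using H(2) G by (auto simp: compose_def qfunctor_def PiE_def extensional_def)
  let ?s = "T\<^sub>1 A (T B) H t"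
  have s: "?s \<in> Ob (T (T B))" using qfunctor_Ob[OF T1_qfunctor[OF A T_QCat[OF B] Hf] t] .
  have "is_colim Q A (PSh Q B) \<phi> G (\<epsilon> B (\<mu> B ?s))"
    using eps_mu[OF B s] is_colim_PSh_map[OF QCat_qcategory[OF A] T_qcategory[OF B]
        qcategory_PSh[OF QCat_qcategory[OF B]] Hf eps_qfunctor[OF B] eps_presheaf[OF A t]]
    by (simp add: eps_T1[OF A T_QCat[OF B] Hf t] comp phi)
  then have "colim Q A (PSh Q B) \<phi> G = \<epsilon> B (\<mu> B ?s)"
    using is_colim_PSh_iff[OF QCat_qcategory[OF A] QCat_qcategory[OF B] G] eps_presheaf[OF A t] phi by simp
  then show ?thesis
    using B qfunctor_Ob[OF mu_qfunctor[OF B] s] by (auto simp: doctrine_class_def)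
qed

lemma saturated_doctrine_class: "saturated small Q (doctrine_class small Q T \<epsilon>)"
  unfolding saturated_def
proof (intro conjI ballI allI impI)
  show "presheaf_class small Q (doctrine_class small Q T \<epsilon>)"
    using eps_presheaf by (auto simp: presheaf_class_def doctrine_class_def)
  show "(A, yoneda A a) \<in> doctrine_class small Q T \<epsilon>" if "A \<in> QCat small Q" "a \<in> Ob A" for A a
    using eps_eta[OF that] qfunctor_Ob[OF eta_qfunctor] that by (force simp: doctrine_class_def)
qed (use colim_in_doctrine_class in blast)

section \<open>Algebras\<close>

text \<open>Full faithfulness turns the hom from \<open>\<epsilon> B t\<close> to
  \<open>yoneda B b\<close> into \<open>Hm (T B) t (\<eta> B b)\<close>, so \<open>c\<close> is the
  value at \<open>t\<close> of a left adjoint to \<open>\<eta> B\<close>.\<close>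

lemma is_colim_eps_iff:
  assumes B: "B \<in> QCat small Q" and t: "t \<in> Ob (T B)"
  shows "is_colim Q B B (\<epsilon> B t) (id_functor B) c \<longleftrightarrow>
    c \<in> Ob B \<and> Ty B c = Ty (T B) t \<and> (\<forall>b\<in>Ob B. Hm B c b = Hm (T B) t (\<eta> B b))"
  using is_colim_id_iff[OF QCat_qcategory[OF B] eps_presheaf[OF B t], of c] eps_fst[OF B t]
    eps_Hm[OF B t qfunctor_Ob[OF eta_qfunctor[OF B]]] eps_eta[OF B] by simp

text \<open>The unit law alone makes \<open>L\<close> left adjoint to \<open>\<eta> B\<close>: the presheaf \<open>\<epsilon> B t\<close> has values
  \<open>(T B) (\<eta> b, t) \<le> B (L (\<eta> b), L t) = B (b, L t)\<close>, so it lies below the representable of \<open>L t\<close>,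
  which is the inequality \<open>1 \<le> \<eta> L\<close>.\<close>

lemma is_colim_of_unit_law:
  assumes B: "B \<in> QCat small Q" and L: "qfunctor Q (T B) B L"
    and unit_law: "\<And>b. b \<in> Ob B \<Longrightarrow> obj_iso B (L (\<eta> B b)) b" and t: "t \<in> Ob (T B)"
  shows "is_colim Q B B (\<epsilon> B t) (id_functor B) (L t)"
proof -
  note cB = QCat_qcategory[OF B] and cTB = T_qcategory[OF B] and E = eta_qfunctor[OF B]
  have Lt: "L t \<in> Ob B" "Ty B (L t) = Ty (T B) t" using qfunctor_Ob[OF L t] qfunctor_Ty[OF L t] .
  have iso: "Hm B (L (\<eta> B b)) d = Hm B b d" "Hm B d (L (\<eta> B b)) = Hm B d b"
    if "b \<in> Ob B" "d \<in> Ob B" for b d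
  proof -
    have b: "L (\<eta> B b) \<in> Ob B" "Ty B (L (\<eta> B b)) = Ty B b"
      using unit_law[OF that(1)] by (auto simp: obj_iso_def)
    show "Hm B (L (\<eta> B b)) d = Hm B b d"
      using unit_law[OF that(1)] that(2) by (auto simp: obj_iso_def)
    \<comment> \<open>\<open>obj_iso\<close> gives equal rows; equality of columns comes from the
      second claim of \<open>obj_iso_iff\<close>.\<close>
    show "Hm B d (L (\<eta> B b)) = Hm B d b"
      using obj_iso_iff(2)[OF cB b(1) that(1) b(2)] unit_law[OF that(1)] that Hm_Hom[OF cB]
        b Leq_antisym by (metis (no_types, lifting))
  qed
  have below: "snd (\<epsilon> B t) b () \<preceq> Hm B b (L t)" if b: "b \<in> Ob B" for b
    using qfunctor_Hm[OF L qfunctor_Ob[OF E b] t] eps_value[OF B b t] iso(1)[OF b Lt(1)] by simp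
  have "Hm B (L t) b = Hm (T B) t (\<eta> B b)" if b: "b \<in> Ob B" for b
  proof (rule Leq_antisym)
    have e: "\<eta> B b \<in> Ob (T B)" "Ty (T B) (\<eta> B b) = Ty B b"
      using qfunctor_Ob[OF E b] qfunctor_Ty[OF E b] .
    show H: "Hm B (L t) b \<in> Hom Q (Ty B b) (Ty (T B) t)" using Hm_Hom[OF cB Lt(1) b] Lt(2) by simp
    show "Hm (T B) t (\<eta> B b) \<in> Hom Q (Ty B b) (Ty (T B) t)" using Hm_Hom[OF cTB t e(1)] e(2) by simp
    \<comment> \<open>Functoriality of \<open>L\<close>, with \<open>L (\<eta> B b)\<close> replaced
      by the isomorphic \<open>b\<close>.\<close>
    show "Hm (T B) t (\<eta> B b) \<preceq> Hm B (L t) b"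
      using qfunctor_Hm[OF L t e(1)] iso(2)[OF b Lt(1)] by simp
    \<comment> \<open>For the converse, residuation reduces the claim to composing
      \<open>below\<close> with \<open>Hm B (L t) b\<close>.\<close>
    have "snd (\<epsilon> B t) a () \<cdot> Hm B (L t) b \<preceq> Hm B a b" if a: "a \<in> Ob B" for a
      using Hm_Cmp_le[OF cB a Lt(1) b below[OF a] Leq_refl[OF H] _ Hm_Hom[OF cB Lt(1) b]]
        presheaf_Hom[OF eps_presheaf[OF B t] a] eps_fst[OF B t] Lt(2) by simp
    then have "Hm B (L t) b \<preceq> Hm (PSh Q B) (\<epsilon> B t) (yoneda B b)"
      using le_Hm_PSh_iff[OF cB eps_presheaf[OF B t] yoneda_presheaf[OF cB b]] H eps_fst[OF B t] b by simp
    then show "Hm B (L t) b \<preceq> Hm (T B) t (\<eta> B b)"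
      using eps_Hm[OF B t e(1)] eps_eta[OF B b] by simp
  qed
  then show ?thesis using is_colim_eps_iff[OF B t] Lt by simp
qed

lemma algebra_is_colim_id:
  assumes alg: "is_algebra small Q T T\<^sub>1 \<mu> \<eta> B L" and t: "t \<in> Ob (T B)"
  shows "is_colim Q B B (\<epsilon> B t) (id_functor B) (L t)"
proof -
  have B: "B \<in> QCat small Q" and L: "qfunctor Q (T B) B L"
    and iso: "functor_iso Q B B (comp_functor B L (\<eta> B)) (id_functor B)"
    using alg by (simp_all add: is_algebra_def)
  note E = eta_qfunctor[OF B]
  have "obj_iso B (L (\<eta> B b)) b" if "b \<in> Ob B" for b
    using iso functor_iso_iff[OF QCat_qcategory[OF B], of B "comp_functor B L (\<eta> B)" "id_functor B"]
      qfunctor_Ob[OF L qfunctor_Ob[OF E]] qfunctor_Ty[OF L qfunctor_Ob[OF E]] qfunctor_Ty[OF E] that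
    by (simp add: compose_eq)
  then show ?thesis using is_colim_of_unit_law[OF B L _ t] by blast
qed

lemma algebra_is_colim:
  assumes alg: "is_algebra small Q T T\<^sub>1 \<mu> \<eta> B L" and A: "A \<in> QCat small Q"
    and t: "t \<in> Ob (T A)" and F: "qfunctor Q A B F"
  shows "is_colim Q A B (\<epsilon> A t) F (L (T\<^sub>1 A B F t))"
proof -
  have B: "B \<in> QCat small Q" using alg by (simp add: is_algebra_def)
  show ?thesis
    using algebra_is_colim_id[OF alg qfunctor_Ob[OF T1_qfunctor[OF A B F] t]]
      is_colim_PSh_map_id[OF QCat_qcategory[OF A] QCat_qcategory[OF B] F eps_presheaf[OF A t]]
    by (simp add: eps_T1[OF A B F t])
qed

section \<open>Algebras and cocompleteness\<close>

lemma algebra_cocomplete: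
  assumes "is_algebra small Q T T\<^sub>1 \<mu> \<eta> B L"
  shows "cocomplete small Q (doctrine_class small Q T \<epsilon>) B"
proof -
  have "\<exists>c. is_colim Q A B \<phi> F c"
    if "(A, \<phi>) \<in> doctrine_class small Q T \<epsilon>" "qfunctor Q A B F" for A \<phi> F
  proof -
    from that(1) obtain t where "A \<in> QCat small Q" "t \<in> Ob (T A)" "\<phi> = \<epsilon> A t"
      by (auto simp: doctrine_class_def)
    then show ?thesis using algebra_is_colim[OF assms _ _ that(2)] by blast
  qed
  then show ?thesis using assms by (auto simp: cocomplete_def is_algebra_def)
qed

text \<open>The structure map chooses colimits of the identity, which exist because each
  \<open>(B, \<epsilon> B t)\<close> lies in the class. Both laws hold because the two objects they
  compare are colimits of the same diagram with the same weight.\<close>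

lemma cocomplete_algebra:
  assumes "cocomplete small Q (doctrine_class small Q T \<epsilon>) B"
  shows "\<exists>L. is_algebra small Q T T\<^sub>1 \<mu> \<eta> B L"
proof -
  have B: "B \<in> QCat small Q"
    and ex: "\<And>A \<phi> F. (A, \<phi>) \<in> doctrine_class small Q T \<epsilon> \<Longrightarrow> qfunctor Q A B F \<Longrightarrow> \<exists>c. is_colim Q A B \<phi> F c"
    using assms by (auto simp: cocomplete_def)
  note cB = QCat_qcategory[OF B] and cTB = T_qcategory[OF B] and E = eta_qfunctor[OF B]
    and M = mu_qfunctor[OF B]
  have "\<exists>c. is_colim Q B B (\<epsilon> B t) (id_functor B) c" if "t \<in> Ob (T B)" for t
    by (rule ex[OF _ qfunctor_id[OF cB]]) (use B that in \<open>auto simp: doctrine_class_def\<close>)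
  then obtain l where l: "\<And>t. t \<in> Ob (T B) \<Longrightarrow> is_colim Q B B (\<epsilon> B t) (id_functor B) (l t)" by metis
  define L where "L = (\<lambda>t\<in>Ob (T B). l t)"
  have col: "is_colim Q B B (\<epsilon> B t) (id_functor B) (L t)" if "t \<in> Ob (T B)" for t
    using l[OF that] that by (simp add: L_def)
  have Lt: "L t \<in> Ob B" "Ty B (L t) = Ty (T B) t" if "t \<in> Ob (T B)" for t
    using col[OF that] is_colim_eps_iff[OF B that] by auto
  have LH: "Hm B (L t) b = Hm (T B) t (\<eta> B b)" if "t \<in> Ob (T B)" "b \<in> Ob B" for t b
    using col[OF that(1)] is_colim_eps_iff[OF B that(1)] that(2) by auto
  have L: "qfunctor Q (T B) B L"
    unfolding qfunctor_def
  proof (intro conjI ballI)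
    show "L \<in> Ob (T B) \<rightarrow>\<^sub>E Ob B" using Lt(1) by (auto simp: L_def PiE_iff)
    fix s t assume s: "s \<in> Ob (T B)" and t: "t \<in> Ob (T B)"
    note es = eps_presheaf[OF B s] and et = eps_presheaf[OF B t]
    let ?f = "Hm (T B) s t"
    have f: "?f \<in> Hom Q (Ty (T B) t) (Ty (T B) s)" using Hm_Hom[OF cTB s t] .
    \<comment> \<open>By the universal property of \<open>L s\<close> a cocone suffices:
      \<open>?f\<close> carries \<open>\<epsilon> B s\<close> below \<open>\<epsilon> B t\<close>,
      and the colimit cocone leads on to \<open>L t\<close>.\<close>
    have "snd (\<epsilon> B s) b () \<cdot> ?f \<preceq> Hm B (id_functor B b) (L t)" if b: "b \<in> Ob B" for b
    proof -
      have "snd (\<epsilon> B s) b () \<cdot> ?f \<preceq> snd (\<epsilon> B t) b ()"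
        using PSh_eval[OF cB es et b] eps_Hm[OF B s t] by simp
      moreover have "snd (\<epsilon> B t) b () \<preceq> Hm B b (L t)"
        using is_colim_cocone[OF cB cB qfunctor_id[OF cB] et col[OF t] b] b by simp
      ultimately show ?thesis
        using Leq_trans[OF _ _ Cmp_Hom[OF f] _ Hm_Hom[OF cB b Lt(1)[OF t], unfolded Lt(2)[OF t]]]
          presheaf_Hom[OF es b] presheaf_Hom[OF et b] eps_fst[OF B s] eps_fst[OF B t] b
        by simp
    qed
    then show "?f \<preceq> Hm B (L s) (L t)"
      using col[OF s, unfolded is_colim_iff[OF cB cB qfunctor_id[OF cB] es]] Lt[OF t] f eps_fst[OF B s]
      by simp
  qed (use Lt in simp)
  have unit_law: "obj_iso B (L (\<eta> B b)) b" if b: "b \<in> Ob B" for b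
    using is_colim_unique[OF col[OF qfunctor_Ob[OF E b]]] is_colim_yoneda[OF cB b] eps_eta[OF B b] by simp
  have assoc: "obj_iso B (L (\<mu> B s)) (L (T\<^sub>1 (T B) B L s))" if s: "s \<in> Ob (T (T B))" for s
  proof (rule is_colim_unique)
    note es = eps_presheaf[OF T_QCat[OF B] s]
    show "is_colim Q (T B) B (\<epsilon> (T B) s) L (L (T\<^sub>1 (T B) B L s))"
      using col[OF qfunctor_Ob[OF T1_qfunctor[OF T_QCat[OF B] B L] s]]
        is_colim_PSh_map_id[OF cTB cB L es]
      by (simp add: eps_T1[OF T_QCat[OF B] B L s])
    have m: "\<mu> B s \<in> Ob (T B)" using qfunctor_Ob[OF M s] .
    \<comment> \<open>The colimit property of \<open>\<epsilon> B (\<mu> B s)\<close> is evaluated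
      at \<open>yoneda B b\<close>: homs into it are homs \<open>Hm B (L t) b\<close>, both for the
      objects of the diagram and for \<open>\<mu> B s\<close>.\<close>
    have "f \<preceq> Hm B (L (\<mu> B s)) b \<longleftrightarrow> (\<forall>t\<in>Ob (T B). snd (\<epsilon> (T B) s) t () \<cdot> f \<preceq> Hm B (L t) b)"
      if b: "b \<in> Ob B" and f: "f \<in> Hom Q (Ty B b) (fst (\<epsilon> (T B) s))" for b f
    proof -
      have e: "\<eta> B b \<in> Ob (T B)" using qfunctor_Ob[OF E b] .
      have "Hm B (L t) b = Hm (PSh Q B) (\<epsilon> B t) (yoneda B b)" if "t \<in> Ob (T B)" for t
        using LH[OF that b] eps_Hm[OF B that e] eps_eta[OF B b] by simp
      then show ?thesis
        using eps_mu[OF B s, unfolded is_colim_iff[OF cTB qcategory_PSh[OF cB] eps_qfunctor[OF B] es]]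
          yoneda_presheaf[OF cB b] b f m by simp
    qed
    then show "is_colim Q (T B) B (\<epsilon> (T B) s) L (L (\<mu> B s))"
      using Lt[OF m] eps_fst[OF T_QCat[OF B] s] qfunctor_Ty[OF M s]
      by (simp add: is_colim_iff[OF cTB cB L es])
  qed
  have "functor_iso Q B B (comp_functor B L (\<eta> B)) (id_functor B)"
    by (intro functor_iso_iff[OF cB, THEN iffD2] ballI)
      (simp_all add: compose_eq unit_law obj_iso_Ob(1)[OF unit_law] obj_iso_Ty[OF unit_law])
  moreover have "functor_iso Q (T (T B)) B (comp_functor (T (T B)) L (\<mu> B))
      (comp_functor (T (T B)) L (T\<^sub>1 (T B) B L))"
    by (intro functor_iso_iff[OF cB, THEN iffD2] ballI)
      (simp_all add: compose_eq assoc obj_iso_Ob[OF assoc] obj_iso_Ty[OF assoc])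
  ultimately show ?thesis using B L unfolding is_algebra_def by blast
qed

section \<open>Homomorphisms and cocontinuity\<close>

text \<open>\<open>L' (T\<^sub>1 B B' G t)\<close> is the colimit of \<open>G\<close> weighted by
  \<open>\<epsilon> B t\<close>. So the homomorphism law says that \<open>G\<close> preserves these
  colimits of the identity, and change of weight extends this to all diagrams.\<close>

lemma algebra_hom_iff_cocontinuous:
  assumes alg: "is_algebra small Q T T\<^sub>1 \<mu> \<eta> B L" and alg': "is_algebra small Q T T\<^sub>1 \<mu> \<eta> B' L'"
  shows "is_algebra_hom Q T T\<^sub>1 B L B' L' G \<longleftrightarrow>
    cocontinuous Q (doctrine_class small Q T \<epsilon>) B B' G"
proof (cases "qfunctor Q B B' G")
  case G: True
  have B: "B \<in> QCat small Q" and L: "qfunctor Q (T B) B L"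
    and B': "B' \<in> QCat small Q" and L': "qfunctor Q (T B') B' L'"
    using alg alg' by (simp_all add: is_algebra_def)
  note cB = QCat_qcategory[OF B] and cB' = QCat_qcategory[OF B'] and T1G = T1_qfunctor[OF B B' G]
  have hom_iff: "is_algebra_hom Q T T\<^sub>1 B L B' L' G \<longleftrightarrow>
      (\<forall>t\<in>Ob (T B). obj_iso B' (G (L t)) (L' (T\<^sub>1 B B' G t)))"
    unfolding is_algebra_hom_def
    using G qfunctor_Ob[OF G qfunctor_Ob[OF L]] qfunctor_Ty[OF G qfunctor_Ob[OF L]] qfunctor_Ty[OF L]
      qfunctor_Ob[OF L' qfunctor_Ob[OF T1G]] qfunctor_Ty[OF L' qfunctor_Ob[OF T1G]] qfunctor_Ty[OF T1G]
    by (subst functor_iso_iff[OF cB']) (simp_all add: compose_eq)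
  show ?thesis
  proof
    assume hom: "is_algebra_hom Q T T\<^sub>1 B L B' L' G"
    have "is_colim Q A B' \<phi> (comp_functor A G F) (G c)"
      if C: "(A, \<phi>) \<in> doctrine_class small Q T \<epsilon>" and F: "qfunctor Q A B F" and c: "is_colim Q A B \<phi> F c"
      for A \<phi> F c
    proof -
      from C obtain t where A: "A \<in> QCat small Q" and t: "t \<in> Ob (T A)" and phi: "\<phi> = \<epsilon> A t"
        by (auto simp: doctrine_class_def)
      let ?u = "T\<^sub>1 A B F t"
      have u: "?u \<in> Ob (T B)" using qfunctor_Ob[OF T1_qfunctor[OF A B F] t] .
      \<comment> \<open>Up to isomorphism \<open>c\<close> is the colimit chosen by
        \<open>L\<close>, to which the homomorphism law applies.\<close>
      have "obj_iso B c (L ?u)"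
        using is_colim_unique[OF c] algebra_is_colim[OF alg A t F] phi by simp
      from obj_iso_trans[OF qfunctor_obj_iso[OF G cB cB' this] bspec[OF hom[unfolded hom_iff] u]]
      have iso: "obj_iso B' (G c) (L' (T\<^sub>1 B B' G ?u))" .
      have "is_colim Q A B' \<phi> (comp_functor A G F) (L' (T\<^sub>1 B B' G ?u))"
        using algebra_is_colim[OF alg' B u G] is_colim_PSh_map[OF QCat_qcategory[OF A] cB cB' F G
            eps_presheaf[OF A t]]
        by (simp add: eps_T1[OF A B F t] phi)
      from is_colim_obj_iso[OF this obj_iso_sym[OF iso]] show ?thesis .
    qed
    then show "cocontinuous Q (doctrine_class small Q T \<epsilon>) B B' G"
      using G by (auto simp: cocontinuous_def)
  next
    assume cc: "cocontinuous Q (doctrine_class small Q T \<epsilon>) B B' G"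
    \<comment> \<open>Cocontinuity is applied to the identity diagram with weight
      \<open>\<epsilon> B t\<close>, whose colimit is \<open>L t\<close>.\<close>
    have "obj_iso B' (G (L t)) (L' (T\<^sub>1 B B' G t))" if t: "t \<in> Ob (T B)" for t
    proof (rule is_colim_unique)
      have "(B, \<epsilon> B t) \<in> doctrine_class small Q T \<epsilon>" using B t by (auto simp: doctrine_class_def)
      then have "is_colim Q B B' (\<epsilon> B t) (comp_functor B G (id_functor B)) (G (L t))"
        using cc qfunctor_id[OF cB] algebra_is_colim_id[OF alg t] unfolding cocontinuous_def by blast
      then show "is_colim Q B B' (\<epsilon> B t) G (G (L t))"
        by (simp only: comp_functor_id_right[OF G])
      show "is_colim Q B B' (\<epsilon> B t) G (L' (T\<^sub>1 B B' G t))"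
        using algebra_is_colim[OF alg' B t G] .
    qed
    then show "is_algebra_hom Q T T\<^sub>1 B L B' L' G" using hom_iff by blast
  qed
\<comment> \<open>If \<open>G\<close> is not a functor, both sides are false.\<close>
qed (simp add: is_algebra_hom_def cocontinuous_def)

end

theorem proposition4p5:
  fixes Q :: "('o, 'm) quantaloid_data"
    and small :: "'u set \<Rightarrow> bool"
    and T :: "('u, 'o, 'm) qcat \<Rightarrow> ('u, 'o, 'm) qcat"
    and T\<^sub>1 :: "('u, 'o, 'm) qcat \<Rightarrow> ('u, 'o, 'm) qcat \<Rightarrow> ('u \<Rightarrow> 'u) \<Rightarrow> 'u \<Rightarrow> 'u"
    and \<epsilon> :: "('u, 'o, 'm) qcat \<Rightarrow> 'u \<Rightarrow> ('u, 'o, 'm) presheaf"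
  assumes "quantaloid Q"
    and "full_sub_KZ_doctrine small Q T T\<^sub>1 \<epsilon>"
  shows "saturated small Q (doctrine_class small Q T \<epsilon>) \<and>
    (\<forall>\<mu> \<eta>. mult_factorisation small Q T \<epsilon> \<mu> \<and> unit_factorisation small Q T \<epsilon> \<eta> \<longrightarrow>
      (\<forall>B. (\<exists>L. is_algebra small Q T T\<^sub>1 \<mu> \<eta> B L) \<longleftrightarrow>
           cocomplete small Q (doctrine_class small Q T \<epsilon>) B) \<and>
      (\<forall>B L B' L' G. is_algebra small Q T T\<^sub>1 \<mu> \<eta> B L \<and> is_algebra small Q T T\<^sub>1 \<mu> \<eta> B' L' \<longrightarrow>
           (is_algebra_hom Q T T\<^sub>1 B L B' L' G \<longleftrightarrow>
            cocontinuous Q (doctrine_class small Q T \<epsilon>) B B' G)))"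
proof -
  \<comment> \<open>Saturation does not mention \<mu> and \<eta>, so any pair supplied by the
    doctrine serves to enter the locale.\<close>
  obtain \<mu> \<eta> where "mult_factorisation small Q T \<epsilon> \<mu>" "unit_factorisation small Q T \<epsilon> \<eta>"
    using assms(2) by (auto simp: full_sub_KZ_doctrine_def)
  then interpret sub_KZ Q small T T\<^sub>1 \<epsilon> \<mu> \<eta>
    using assms by (simp add: sub_KZ_def sub_KZ_axioms_def)
  show ?thesis
  proof (intro conjI allI impI saturated_doctrine_class, goal_cases)
    case (1 \<mu> \<eta> B)
    \<comment> \<open>The claims on algebras concern arbitrary \<mu> and \<eta>, for which the
      locale is interpreted anew.\<close>
    then interpret sub_KZ Q small T T\<^sub>1 \<epsilon> \<mu> \<eta>
      using assms by (simp add: sub_KZ_def sub_KZ_axioms_def)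
    show ?case using algebra_cocomplete cocomplete_algebra by blast
  next
    case (2 \<mu> \<eta> B L B' L' G)
    then interpret sub_KZ Q small T T\<^sub>1 \<epsilon> \<mu> \<eta>
      using assms by (simp add: sub_KZ_def sub_KZ_axioms_def)
    show ?case using algebra_hom_iff_cocontinuous 2(2) by blast
  qed
qed

end
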